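(* Let $A$, $B$, $B'$ and $C$ be matrices in $\mathbb{C}^{d\times d}$, with $C+kI$ invertible for all integers $k\ge0$. Then the matrix function $\mathcal{H}_2(A,B,B';C;x,y)$ satisfies the following infinite summation formulae for $|t|<1$: (1) $(1-t)^{-A}\,\mathcal{H}_2\!\left(A,B,B';C;\frac{x}{1-t},y(1-t)\right)=\sum_{n=0}^{\infty}\frac{(A)_n}{n!}\,\mathcal{H}_2(A+nI,B,B';C;x,y)\,t^n$; (2) if $AB=BA$, $(1-t)^{-B}\,\mathcal{H}_2\!\left(A,B,B';C;\frac{x}{1-t},y\right)=\sum_{n=0}^{\infty}\frac{(B)_n}{n!}\,\mathcal{H}_2(A,B+nI,B';C;x,y)\,t^n$; (3) if $B'C=CB'$, $\mathcal{H}_2\!\left(A,B,B';C;x,\frac{y}{1-t}\right)(1-t)^{-B'}=\sum_{n=0}^{\infty}\mathcal{H}_2(A,B,B'+nI;C;x,y)\,\frac{(B')_n}{n!}\,t^n$.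
   Context: $\mathcal{H}_2(A,B,B';C;x,y)=\sum_{m,n\ge0}(A)_{m-n}(B)_m(B')_n(C)_m^{-1}\frac{x^m y^n}{m!\,n!}$. Matrix Pochhammer symbol: for $M\in\mathbb{C}^{d\times d}$, $(M)_0=I$, $(M)_n=M(M+I)\cdots(M+(n-1)I)$ for $n\ge1$, and $(M)_{-n}=(-1)^n(I-M)_n^{-1}$; $(M)_n^{-1}$ is the inverse matrix of $(M)_n$. For $|t|<1$, $(1-t)^{-M}=\sum_{n\ge0}\frac{(M)_n}{n!}t^n$.
   Formalization: Assumes |x|<1 and A-kI invertible (k>=1); in (1) A+kI invertible for all integers k; in (1),(2) also |x/(1-t)|<1 and either |x|+|t|<1 or convergence of the right-hand series, since |t|<1 alone fails (d=1, B=C=1, A=1/2, y=0, x=1/2, t=-9/10). *)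

theory Defs
  imports "HOL-Analysis.Analysis"
begin

type_synonym 'd cmat = "complex ^ 'd ^ 'd"

text \<open>Multiplication of a matrix by a complex scalar (the library operation \<open>*\<^sub>R\<close> only
  allows real scalars, and \<open>*s\<close> at this type would take a row vector as its scalar).\<close>

definition cscale :: "complex \<Rightarrow> 'd::finite cmat \<Rightarrow> 'd cmat"  (infixr \<open>*\<^sub>C\<close> 75)
  where "c *\<^sub>C M = (\<chi> i j. c * M $ i $ j)"

primrec mpoch_nat :: "'d::finite cmat \<Rightarrow> nat \<Rightarrow> 'd cmat" where
  "mpoch_nat M 0 = mat 1"
| "mpoch_nat M (Suc n) = mpoch_nat M n ** (M + mat (of_nat n))"

text \<open>The symbol $(M)_k$ for integer $k$. For $k < 0$ it is meaningful only if $M - jI$ is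
  invertible for $1 \le j \le -k$; otherwise \<open>matrix_inv\<close> returns an unspecified matrix.\<close>

definition mpoch :: "'d::finite cmat \<Rightarrow> int \<Rightarrow> 'd cmat" where
  "mpoch M k = (if k \<ge> 0 then mpoch_nat M (nat k)
     else (-1) ^ nat (- k) *\<^sub>C matrix_inv (mpoch_nat (mat 1 - M) (nat (- k))))"

text \<open>$(1-t)^{-M}$ for $|t| < 1$.\<close>

definition one_minus_powr_neg :: "complex \<Rightarrow> 'd::finite cmat \<Rightarrow> 'd cmat" where
  "one_minus_powr_neg t M = (\<Sum>n. (t ^ n / fact n) *\<^sub>C mpoch_nat M n)"

text \<open>The double series is summed unconditionally. If $C + kI$ $(k \ge 0)$ and $A - kI$
  $(k \ge 1)$ are invertible, it converges for $|x| < 1$ and every $y$.\<close>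

definition H2 :: "'d::finite cmat \<Rightarrow> 'd cmat \<Rightarrow> 'd cmat \<Rightarrow> 'd cmat \<Rightarrow> complex \<Rightarrow> complex \<Rightarrow> 'd cmat"
  where
  "H2 A B B' C x y =
     (\<Sum>\<^sub>\<infinity>(m, n)\<in>UNIV. (x ^ m * y ^ n / (fact m * fact n)) *\<^sub>C
        (mpoch A (int m - int n) ** mpoch_nat B m ** mpoch_nat B' n
           ** matrix_inv (mpoch_nat C m)))"

end

theory Submission
  imports Defs "HOL-Complex_Analysis.Conformal_Mappings" "HOL-Real_Asymp.Real_Asymp"
begin

text \<open>Each formula is an interchange of summations in a triple series. In the first one, insert the
  double series of \<open>H2\<close> on the right-hand side. Since
  $(A)_n (A+nI)_{m-k} = (A)_{n+m-k} = (A)_{m-k} (A+(m-k)I)_n$, the sum over $n$ is a binomial series with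
  value $(A)_{m-k} (1-t)^{-(A+(m-k)I)} = (1-t)^{k-m} (1-t)^{-A} (A)_{m-k}$, and the scalar $(1-t)^{k-m}$ is
  absorbed by the arguments $x/(1-t)$ and $y(1-t)$. The other two formulae are the same computation with
  $(B)_{n+m}$ and $(B')_{n+k}$; the commutation hypotheses bring the factors that depend on $n$ next to
  each other.

  The interchange is justified by absolute convergence. For every $r > 1$ there is a constant $K$ with
  $\|(M)_n\| \le K r^n n!$, $\|(C)_n^{-1}\| \le K r^n / n!$ and
  $\|(A)_{N-k}\| \le K r^{N+k} 2^k N! / k!$ (\<open>mpoch_nat_growth\<close>, \<open>inverse_mpoch_nat_growth\<close>,
  \<open>mpoch_growth\<close>). In the first two formulae this yields the majorant
  $\binom{n+m}{n} (r|t|)^n (r^3|x|)^m (2r^2|y|)^k / k!$, which is summable if $|t| + |x| < 1$ and $r$ is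
  close to $1$. In the third one the binomial coefficient is $\binom{n+k}{n}$, which the factor $1/k!$
  compensates, so that $|t| < 1$ and $|x| < 1$ suffice.

  If $|t| + |x| \ge 1$ in the first two formulae, the series on the right is only assumed to converge at
  $t$, perhaps conditionally. As a power series it is holomorphic for $|s| < |t|$, while the left-hand
  side is holomorphic for $|s| < 1$, $|1-s| > |x|$. The intersection of these two sets is connected, and
  the two sides agree near $0$; Abel's limit theorem extends the identity to $t$
  (\<open>power_series_sums_continuation\<close>).\<close>

section \<open>Matrix algebra\<close>

lemma mat_add: "mat (a + b) = (mat a + mat b :: 'd::finite cmat)"
  by (simp add: mat_def vec_eq_iff)

lemma mat_zero: "mat 0 = (0 :: 'd::finite cmat)"
  by (simp add: mat_def vec_eq_iff)

lemma matrix_add_rdistrib: "(M + N) ** X = M ** X + N ** (X :: 'd::finite cmat)"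
  by (simp add: matrix_matrix_mult_def vec_eq_iff algebra_simps sum.distrib)

lemma cscale_eq_mat_mult: "c *\<^sub>C M = mat c ** M"
  unfolding cscale_def vec_eq_iff matrix_matrix_mult_def mat_def
  by (auto simp: if_distrib[of "\<lambda>x. x * _"] cong: if_cong)

lemma mat_commute: "mat c ** M = M ** (mat c :: 'd::finite cmat)"
  unfolding vec_eq_iff matrix_matrix_mult_def mat_def
  by (auto simp: if_distrib[of "\<lambda>x. x * _"] if_distrib[of "\<lambda>x. _ * x"] mult.commute cong: if_cong)

lemma cscale_mult_left: "(c *\<^sub>C M) ** N = c *\<^sub>C (M ** N)"
  by (simp add: cscale_eq_mat_mult matrix_mul_assoc)

lemma cscale_mult_right: "M ** (c *\<^sub>C N) = c *\<^sub>C (M ** N)"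
  by (metis cscale_eq_mat_mult mat_commute matrix_mul_assoc)

lemma cscale_cscale: "a *\<^sub>C b *\<^sub>C M = (a * b) *\<^sub>C M"
  by (simp add: cscale_def mult.assoc)

lemma cscale_one: "1 *\<^sub>C M = M"
  by (simp add: cscale_def)

lemma cscale_diff_left: "(a - b) *\<^sub>C M = a *\<^sub>C M - b *\<^sub>C M"
  by (simp add: cscale_def vec_eq_iff algebra_simps)

lemma cscale_diff_right: "c *\<^sub>C (M - N) = c *\<^sub>C M - c *\<^sub>C N"
  by (simp add: cscale_def vec_eq_iff algebra_simps)

lemma cscale_nth: "(c *\<^sub>C M) $ i $ j = c * M $ i $ j"
  by (simp add: cscale_def)

lemma cscale_vec: "(c *\<^sub>C M) *v v = c *s (M *v v)"
  unfolding cscale_def matrix_vector_mult_def vector_scalar_mult_def vec_eq_iff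
  by (simp add: sum_distrib_left mult.assoc)

lemma bounded_linear_matrix_mult_left: "bounded_linear (\<lambda>X::'d::finite cmat. M ** X)"
  by (rule linear_conv_bounded_linear[THEN iffD1], rule linearI)
     (simp_all add: matrix_matrix_mult_def vec_eq_iff scaleR_sum_right algebra_simps
        flip: sum.distrib)

lemma bounded_linear_matrix_mult_right: "bounded_linear (\<lambda>X::'d::finite cmat. X ** M)"
  by (rule linear_conv_bounded_linear[THEN iffD1], rule linearI)
     (simp_all add: matrix_matrix_mult_def vec_eq_iff scaleR_sum_right algebra_simps
        flip: sum.distrib)

lemma bounded_linear_cscale: "bounded_linear (\<lambda>X::'d::finite cmat. c *\<^sub>C X)"
  unfolding cscale_eq_mat_mult by (rule bounded_linear_matrix_mult_left)

lemma bounded_linear_entry: "bounded_linear (\<lambda>X::'d::finite cmat. X $ i $ j)"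
  by (intro bounded_linear_compose[OF bounded_linear_vec_nth] bounded_linear_vec_nth)

lemma matrix_inv_works:
  fixes M :: "'d::finite cmat"
  assumes "invertible M"
  shows "M ** matrix_inv M = mat 1" "matrix_inv M ** M = mat 1"
  using someI_ex[OF assms[unfolded invertible_def]] by (simp_all add: matrix_inv_def)

lemma matrix_inv_eqI:
  fixes M :: "'d::finite cmat"
  assumes "M ** N = mat 1"
  shows "matrix_inv M = N"
proof -
  have "invertible M"
    using assms by (metis invertible_right_inverse)
  then have "matrix_inv M = matrix_inv M ** (M ** N)"
    by (simp add: assms)
  also have "\<dots> = N"
    using \<open>invertible M\<close> by (simp add: matrix_mul_assoc matrix_inv_works)
  finally show ?thesis .
qed

lemma matrix_inv_mult:
  fixes M N :: "'d::finite cmat"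
  assumes "invertible M" "invertible N"
  shows "matrix_inv (M ** N) = matrix_inv N ** matrix_inv M"
proof (rule matrix_inv_eqI)
  have "M ** N ** (matrix_inv N ** matrix_inv M) = M ** (N ** matrix_inv N) ** matrix_inv M"
    by (simp add: matrix_mul_assoc)
  then show "M ** N ** (matrix_inv N ** matrix_inv M) = mat 1"
    using assms by (simp add: matrix_inv_works)
qed

lemma matrix_inv_commute:
  fixes M X :: "'d::finite cmat"
  assumes "invertible M" "X ** M = M ** X"
  shows "X ** matrix_inv M = matrix_inv M ** X"
proof -
  have "X ** matrix_inv M = matrix_inv M ** (M ** X) ** matrix_inv M"
    using assms(1) by (simp add: matrix_mul_assoc matrix_inv_works)
  also have "\<dots> = matrix_inv M ** X ** (M ** matrix_inv M)"
    by (simp add: matrix_mul_assoc flip: assms(2))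
  finally show ?thesis
    using assms(1) by (simp add: matrix_inv_works)
qed

section \<open>The operator norm\<close>

definition opnorm :: "'d::finite cmat \<Rightarrow> real"
  where "opnorm M = onorm ((*v) M)"

lemma opnorm_nonneg: "opnorm M \<ge> 0"
  unfolding opnorm_def by (rule onorm_pos_le) simp

lemma opnorm_mult: "opnorm (M ** N) \<le> opnorm M * opnorm N"
  using onorm_compose[OF matrix_vector_mul_bounded_linear matrix_vector_mul_bounded_linear, of M N]
  by (simp add: opnorm_def o_def matrix_vector_mul_assoc)

lemma opnorm_mult_le: "opnorm M \<le> a \<Longrightarrow> opnorm N \<le> b \<Longrightarrow> opnorm (M ** N) \<le> a * b"
  by (rule order_trans[OF opnorm_mult])
     (auto intro!: mult_mono opnorm_nonneg intro: order_trans[OF opnorm_nonneg])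

lemma opnorm_add: "opnorm (M + N) \<le> opnorm M + opnorm N"
  using onorm_triangle[OF matrix_vector_mul_bounded_linear matrix_vector_mul_bounded_linear, of M N]
  by (simp add: opnorm_def matrix_vector_mult_add_rdistrib[abs_def])

lemma opnorm_one: "opnorm (mat 1 :: 'd::finite cmat) \<le> 1"
  unfolding opnorm_def by (rule onorm_bound) simp_all

lemma norm_vector_scalar: "norm (c *s v) = norm c * norm (v :: complex ^ 'd::finite)"
  by (simp add: norm_vec_def L2_set_def norm_mult power_mult_distrib real_sqrt_mult
      flip: sum_distrib_left)

lemma opnorm_cscale_le: "opnorm (c *\<^sub>C M) \<le> norm c * opnorm M"
  unfolding opnorm_def
  by (rule onorm_bound)
     (auto simp: cscale_vec norm_vector_scalar mult.assoc
        intro!: mult_left_mono mult_nonneg_nonneg onorm onorm_pos_le matrix_vector_mul_bounded_linear)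

lemma opnorm_cscale: "opnorm (c *\<^sub>C M) = norm c * opnorm M"
proof (cases "c = 0")
  case True
  then show ?thesis
    using opnorm_cscale_le[of c M] opnorm_nonneg[of "c *\<^sub>C M"] by simp
next
  case False
  have "opnorm M \<le> norm (inverse c) * opnorm (c *\<^sub>C M)"
    using opnorm_cscale_le[of "inverse c" "c *\<^sub>C M"] False by (simp add: cscale_cscale cscale_one)
  then have "norm c * opnorm M \<le> norm c * (norm (inverse c) * opnorm (c *\<^sub>C M))"
    by (intro mult_left_mono) auto
  also have "\<dots> = opnorm (c *\<^sub>C M)"
    using False by (simp add: norm_inverse)
  finally show ?thesis
    using opnorm_cscale_le[of c M] by simp
qed

text \<open>The operator norm, and not the Euclidean norm of the vector of entries, is used below
  because it gives a scalar matrix $cI$ the norm $|c|$ without a dimension factor. The factors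
  $M + nI$ of a Pochhammer symbol then have norm at most $\|M\| + n$, which is what makes the growth
  rates of $(M)_n$ and $n!$ comparable.\<close>

lemma opnorm_mat: "opnorm (mat c :: 'd::finite cmat) \<le> norm c"
proof -
  have "opnorm (mat c :: 'd cmat) = norm c * opnorm (mat 1 :: 'd cmat)"
    by (simp add: cscale_eq_mat_mult flip: opnorm_cscale)
  also have "\<dots> \<le> norm c"
    by (intro mult_left_le opnorm_one norm_ge_zero)
  finally show ?thesis .
qed

lemma norm_entry_le_opnorm: "norm (M $ i $ j) \<le> opnorm M"
proof -
  have "norm (M $ i $ j) \<le> norm (column j M)"
    using Finite_Cartesian_Product.norm_nth_le[of "column j M" i] by (simp add: column_def)
  also have "column j M = M *v axis j 1"
    by (simp add: vec_eq_iff column_def matrix_vector_mult_def axis_def if_distrib cong: if_cong)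
  also have "norm \<dots> \<le> opnorm M * norm (axis j (1 :: complex))"
    unfolding opnorm_def by (rule onorm) simp
  also have "norm (axis j (1 :: complex)) = 1"
    by (simp add: norm_vec_def L2_set_def axis_def if_distrib[of norm] if_distrib[of "\<lambda>x. x ^ 2"]
        cong: if_cong)
  finally show ?thesis by simp
qed

lemma norm_le_opnorm: "norm (M :: 'd::finite cmat) \<le> (real CARD('d))\<^sup>2 * opnorm M"
proof -
  have "norm M \<le> (\<Sum>i\<in>UNIV. norm (M $ i))"
    by (simp add: norm_vec_def L2_set_le_sum)
  also have "\<dots> \<le> (\<Sum>i::'d\<in>UNIV. \<Sum>j::'d\<in>UNIV. norm (M $ i $ j))"
    by (intro sum_mono) (simp add: norm_vec_def L2_set_le_sum)
  also have "\<dots> \<le> (\<Sum>i::'d\<in>UNIV. \<Sum>j::'d\<in>UNIV. opnorm M)"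
    by (intro sum_mono norm_entry_le_opnorm)
  finally show ?thesis
    by (simp add: power2_eq_square mult.assoc)
qed

lemma abs_summable_on_opnorm_comparison:
  fixes f :: "'a \<Rightarrow> 'd::finite cmat"
  assumes "g summable_on S" "\<And>p. p \<in> S \<Longrightarrow> opnorm (f p) \<le> g p"
  shows "(\<lambda>p. norm (f p)) summable_on S"
proof (rule Infinite_Sum.abs_summable_on_comparison_test')
  show "(\<lambda>p. (real CARD('d))\<^sup>2 * g p) summable_on S"
    by (intro summable_on_cmult_right assms)
  show "norm (f p) \<le> (real CARD('d))\<^sup>2 * g p" if "p \<in> S" for p
    by (rule order_trans[OF norm_le_opnorm]) (intro mult_left_mono assms that, simp)
qed

section \<open>Matrix Pochhammer symbols\<close>

lemma mpoch_nat_commute: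
  fixes X M :: "'d::finite cmat"
  assumes "X ** M = M ** X"
  shows "X ** mpoch_nat M n = mpoch_nat M n ** X"
proof (induction n)
  case (Suc n)
  have "X ** mpoch_nat M (Suc n) = mpoch_nat M n ** (X ** (M + mat (of_nat n)))"
    by (simp add: matrix_mul_assoc Suc)
  also have "X ** (M + mat (of_nat n)) = (M + mat (of_nat n)) ** X"
    by (simp add: matrix_add_ldistrib matrix_add_rdistrib assms mat_commute)
  finally show ?case
    by (simp add: matrix_mul_assoc)
qed simp

lemma mpoch_nat_add:
  "mpoch_nat M (a + b) = mpoch_nat M a ** mpoch_nat (M + mat (of_nat a)) b"
  by (induction b) (simp_all add: matrix_mul_assoc add.assoc flip: mat_add)

lemma mpoch_nat_Suc_shift: "mpoch_nat M (Suc n) = M ** mpoch_nat (M + mat 1) n"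
  using mpoch_nat_add[of M 1 n] by (simp add: mat_zero)

lemma invertible_mpoch_nat:
  assumes "\<And>k. invertible (M + mat (of_nat k))"
  shows "invertible (mpoch_nat M n)"
proof (induction n)
  case 0
  show ?case by (auto simp: invertible_def intro: exI[of _ "mat 1"])
qed (simp add: invertible_mult assms)

text \<open>$(A)_{-k} = \pm (I - A)_k^{-1}$ and $(I - A)_k$ is, up to sign, the product of the
  $A - jI$ with $1 \le j \le k$, so this is what makes $(A)_k$ meaningful for every negative $k$.\<close>

definition neg_regular :: "'d::finite cmat \<Rightarrow> bool"
  where "neg_regular A \<longleftrightarrow> (\<forall>k\<ge>1. invertible (A - mat (of_nat k)))"

lemma neg_regular_invertible:
  assumes "neg_regular A"
  shows "invertible (mat 1 - A + mat (of_nat k))"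
proof -
  have "invertible (A - mat (of_nat (Suc k)))"
    using assms by (simp add: neg_regular_def del: of_nat_Suc)
  then obtain Y where Y: "(A - mat (of_nat (Suc k))) ** Y = mat 1"
    by (auto simp: invertible_def)
  have eq: "mat 1 - A + mat (of_nat k) = (-1) *\<^sub>C (A - mat (of_nat (Suc k)))"
    by (simp add: cscale_def vec_eq_iff mat_def)
  have "(mat 1 - A + mat (of_nat k)) ** ((-1) *\<^sub>C Y) = mat 1"
    unfolding eq using Y by (simp add: cscale_mult_left cscale_mult_right cscale_cscale cscale_one)
  then show ?thesis
    by (metis invertible_right_inverse)
qed

lemma invertible_mpoch_nat_reflected:
  "neg_regular A \<Longrightarrow> invertible (mpoch_nat (mat 1 - A) n)"
  by (intro invertible_mpoch_nat neg_regular_invertible)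

lemma mpoch_of_nat: "mpoch A (int n) = mpoch_nat A n"
  by (simp add: mpoch_def)

lemma mpoch_of_neg:
  "mpoch A (- int n) = (-1) ^ n *\<^sub>C matrix_inv (mpoch_nat (mat 1 - A) n)"
  by (cases "n = 0") (simp_all add: mpoch_def cscale_one matrix_inv_eqI)

lemma mpoch_commute:
  fixes X A :: "'d::finite cmat"
  assumes A: "neg_regular A" and X: "X ** A = A ** X"
  shows "X ** mpoch A k = mpoch A k ** X"
proof (cases k rule: int_cases2)
  case (nonneg n)
  then show ?thesis
    using mpoch_nat_commute[OF X] by (simp add: mpoch_of_nat)
next
  case (nonpos n)
  have "X ** (mat 1 - A) + X ** A = (mat 1 - A) ** X + A ** X"
    by (simp flip: matrix_add_ldistrib matrix_add_rdistrib)
  then have "X ** (mat 1 - A) = (mat 1 - A) ** X"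
    unfolding X by (rule add_right_imp_eq)
  from matrix_inv_commute[OF invertible_mpoch_nat_reflected[OF A] mpoch_nat_commute[OF this]]
  show ?thesis
    by (simp add: nonpos mpoch_of_neg cscale_mult_left cscale_mult_right)
qed

text \<open>The recursion $(A)_{k+1} = (A)_k (A + kI)$ is the definition for $k \ge 0$. For
  $k = -(p+1)$ it holds because the last factor of $(I - A)_{p+1}$ is $-(A + kI)$, and the inverse
  of this factor commutes past the other ones.\<close>

lemma mpoch_plus_one:
  assumes A: "neg_regular A"
  shows "mpoch A (k + 1) = mpoch A k ** (A + mat (of_int k))"
proof (cases "k \<ge> 0")
  case True
  then have "nat (k + 1) = Suc (nat k)" by simp
  then show ?thesis
    using True by (simp add: mpoch_def)
next
  case False
  define p where "p = nat (- k - 1)"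
  have k: "k = - int (Suc p)" "k + 1 = - int p"
    using False by (auto simp: p_def)
  define Q where "Q = mpoch_nat (mat 1 - A) p"
  define F where "F = mat 1 - A + mat (of_nat p)"
  have QF: "invertible Q" "invertible F"
    using A by (simp_all add: Q_def F_def invertible_mpoch_nat_reflected neg_regular_invertible)
  have "F ** (mat 1 - A) = (mat 1 - A) ** F"
    by (simp add: F_def matrix_add_ldistrib matrix_add_rdistrib mat_commute)
  then have comm: "F ** matrix_inv Q = matrix_inv Q ** F"
    by (intro matrix_inv_commute QF) (auto simp: Q_def intro: mpoch_nat_commute)
  have *: "A + mat (of_int k) = (-1) *\<^sub>C F"
    by (simp add: F_def k cscale_def vec_eq_iff mat_def)
  have "mpoch A k ** (A + mat (of_int k))
      = ((-1) ^ Suc p * (-1)) *\<^sub>C (matrix_inv (Q ** F) ** F)"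
    unfolding * unfolding k mpoch_of_neg
    by (simp add: cscale_mult_left cscale_mult_right cscale_cscale Q_def F_def)
  also have "matrix_inv (Q ** F) ** F = matrix_inv F ** (matrix_inv Q ** F)"
    using QF by (simp add: matrix_inv_mult matrix_mul_assoc)
  also have "\<dots> = matrix_inv F ** F ** matrix_inv Q"
    by (simp only: comm[symmetric] matrix_mul_assoc)
  also have "\<dots> = matrix_inv Q"
    using QF by (simp add: matrix_inv_works)
  finally show ?thesis
    unfolding k(2) mpoch_of_neg by (simp add: Q_def)
qed

lemma mpoch_add_nat:
  assumes "neg_regular A"
  shows "mpoch A (k + int n) = mpoch A k ** mpoch_nat (A + mat (of_int k)) n"
proof (induction n)
  case (Suc n)
  have "mpoch A (k + int (Suc n)) = mpoch A (k + int n) ** (A + mat (of_int (k + int n)))"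
    using mpoch_plus_one[OF assms, of "k + int n"] by (simp add: ac_simps)
  then show ?case
    by (simp add: Suc matrix_mul_assoc mat_add add.assoc)
qed simp

lemma invertible_cancel_right:
  fixes F :: "'d::finite cmat"
  assumes "invertible F" "X ** F = Y ** F"
  shows "X = Y"
proof -
  have "X ** F ** matrix_inv F = Y ** F ** matrix_inv F"
    by (simp add: assms)
  then show ?thesis
    using assms(1) by (simp add: matrix_inv_works flip: matrix_mul_assoc)
qed

text \<open>As functions of $j$, both sides satisfy the same first-order recursion, with the factor
  $A + (n + j) I$, which can be run backwards because this factor is invertible for $j < 0$.\<close>

lemma mpoch_nat_add_int:
  assumes A: "neg_regular A" and An: "neg_regular (A + mat (of_nat n))"
  shows "mpoch_nat A n ** mpoch (A + mat (of_nat n)) j = mpoch A (int n + j)"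
    (is "?L j = ?R j")
proof -
  let ?F = "\<lambda>j. A + mat (of_int (int n + j)) :: 'a cmat"
  have L: "?L (j + 1) = ?L j ** ?F j" for j
    using mpoch_plus_one[OF An, of j] by (simp add: matrix_mul_assoc add.assoc mat_add)
  have R: "?R (j + 1) = ?R j ** ?F j" for j
    using mpoch_plus_one[OF A, of "int n + j"] by (simp add: add.assoc)
  show ?thesis
  proof (induction j rule: int_induct[where k = 0])
    case base
    then show ?case by (simp add: mpoch_of_nat) (simp add: mpoch_def)
  next
    case (step1 i)
    then show ?case by (simp only: L R)
  next
    case (step2 i)
    have "invertible (A + mat (of_nat n) - mat (of_nat (nat (1 - i))))"
      using An step2 by (simp add: neg_regular_def del: of_nat_nat)
    also have "A + mat (of_nat n) - mat (of_nat (nat (1 - i))) = ?F (i - 1)"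
      using step2 by (simp add: vec_eq_iff mat_def)
    finally have F: "invertible (?F (i - 1))" .
    have "?L (i - 1) ** ?F (i - 1) = ?R (i - 1) ** ?F (i - 1)"
      using L[of "i - 1"] R[of "i - 1"] step2 by simp
    with F show ?case
      by (rule invertible_cancel_right)
  qed
qed

section \<open>Growth of the Pochhammer symbols\<close>

text \<open>Apart from factorials, the growth estimates have the form $K r^n$ with an arbitrary $r > 1$ instead of the sharper
  polynomial rate: each follows from its ratio of consecutive terms tending to $1$, and the loss is
  harmless because $r$ can be chosen so close to $1$ that the strict inequalities on $|x|$ and $|t|$
  survive.\<close>

lemma ratio_bound_imp_geometric_bound:
  fixes u :: "nat \<Rightarrow> real"
  assumes "r > 0" "\<And>n. u n \<ge> 0" "eventually (\<lambda>n. u (Suc n) \<le> r * u n) sequentially"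
  shows "\<exists>K>0. \<forall>n. u n \<le> K * r ^ n"
proof -
  obtain N where N: "\<And>n. n \<ge> N \<Longrightarrow> u (Suc n) \<le> r * u n"
    using assms(3) by (auto simp: eventually_sequentially)
  define K where "K = 1 + (\<Sum>i\<le>N. u i / r ^ i)"
  have "K > 0"
    unfolding K_def using assms by (intro add_pos_nonneg sum_nonneg) auto
  have small: "u n \<le> K * r ^ n" if "n \<le> N" for n
  proof -
    have "u n / r ^ n \<le> (\<Sum>i\<le>N. u i / r ^ i)"
      using assms that by (intro member_le_sum) auto
    then have "u n / r ^ n \<le> K" by (simp add: K_def)
    then show ?thesis using assms by (simp add: field_simps)
  qed
  have "u n \<le> K * r ^ n" if "n \<ge> N" for n
    using that
  proof (induction n rule: dec_induct)
    case (step n)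
    have "u (Suc n) \<le> r * (K * r ^ n)"
      using N[of n] step assms(1) by (intro order_trans[OF N] mult_left_mono) auto
    then show ?case by (simp add: ac_simps)
  qed (rule small, simp)
  with small \<open>K > 0\<close> show ?thesis
    by (metis nle_le)
qed

lemma mpoch_nat_growth:
  fixes M :: "'d::finite cmat"
  assumes "r > 1"
  shows "\<exists>K>0. \<forall>n. opnorm (mpoch_nat M n) \<le> K * r ^ n * fact n"
proof -
  define u where "u n = opnorm (mpoch_nat M n) / fact n" for n
  \<comment> \<open>From this index on, $\|M\| + n \le r (n + 1)$.\<close>
  have "eventually (\<lambda>n. real n \<ge> opnorm M / (r - 1)) sequentially"
    by real_asymp
  then have "eventually (\<lambda>n. u (Suc n) \<le> r * u n) sequentially"
  proof eventually_elim
    case (elim n)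
    have "opnorm M \<le> real n * (r - 1)"
      using elim assms by (simp add: field_simps)
    then have le: "opnorm M + real n \<le> r * real (Suc n)"
      using assms by (simp add: algebra_simps)
    have "opnorm (mpoch_nat M (Suc n)) \<le> opnorm (mpoch_nat M n) * (opnorm M + real n)"
      using opnorm_mat[of "of_nat n", where 'd = 'd] opnorm_add[of M "mat (of_nat n)"]
      by (auto intro!: opnorm_mult_le)
    also have "\<dots> \<le> opnorm (mpoch_nat M n) * (r * real (Suc n))"
      by (intro mult_left_mono le opnorm_nonneg)
    finally show ?case
      by (simp add: u_def field_simps del: mpoch_nat.simps of_nat_Suc)
  qed
  from ratio_bound_imp_geometric_bound[OF _ _ this] obtain K
    where "K > 0" "\<And>n. u n \<le> K * r ^ n"
    using assms by (auto simp: u_def opnorm_nonneg)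
  then show ?thesis
    by (intro exI[of _ K]) (simp add: u_def field_simps)
qed

text \<open>With $X = (M + nI)^{-1}$ the identity $nX = I - MX$ gives
  $n \|X\| \le 1 + \|M\| \|X\|$.\<close>

lemma opnorm_inverse_shift:
  fixes M :: "'d::finite cmat"
  assumes "invertible (M + mat (of_nat n))" "real n > opnorm M"
  shows "opnorm (matrix_inv (M + mat (of_nat n))) \<le> 1 / (real n - opnorm M)"
proof -
  define X where "X = matrix_inv (M + mat (of_nat n))"
  have "M ** X + mat (of_nat n) ** X = mat 1"
    using matrix_inv_works(1)[OF assms(1)] by (simp add: X_def matrix_add_rdistrib)
  then have "of_nat n *\<^sub>C X = mat 1 + (- 1) *\<^sub>C (M ** X)"
    by (simp add: cscale_eq_mat_mult[of "of_nat n"]) (simp add: cscale_def vec_eq_iff algebra_simps)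
  then have "real n * opnorm X \<le> 1 + opnorm M * opnorm X"
    using opnorm_add[of "mat 1" "(- 1) *\<^sub>C (M ** X)"] opnorm_one[where 'd = 'd]
      opnorm_mult[of M X] opnorm_cscale[of "of_nat n" X]
    by (simp add: opnorm_cscale)
  then show ?thesis
    using assms(2) by (simp add: X_def field_simps)
qed

lemma inverse_mpoch_nat_growth:
  fixes M :: "'d::finite cmat"
  assumes r: "r > 1" and M: "\<And>k. invertible (M + mat (of_nat k))"
  shows "\<exists>K>0. \<forall>n. opnorm (matrix_inv (mpoch_nat M n)) \<le> K * r ^ n / fact n"
proof -
  define u where "u n = opnorm (matrix_inv (mpoch_nat M n)) * fact n" for n
  have "eventually (\<lambda>n. real n > opnorm M) sequentially"
    by real_asymp
  \<comment> \<open>From this index on, $(n + 1) / (n - \|M\|) \le r$.\<close>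
  moreover have "eventually (\<lambda>n. real n \<ge> (1 + r * opnorm M) / (r - 1)) sequentially"
    by real_asymp
  ultimately have "eventually (\<lambda>n. u (Suc n) \<le> r * u n) sequentially"
  proof eventually_elim
    case (elim n)
    have "1 + r * opnorm M \<le> real n * (r - 1)"
      using elim r by (simp add: field_simps)
    then have "real (Suc n) / (real n - opnorm M) \<le> r"
      using elim by (simp add: field_simps)
    have "opnorm (matrix_inv (mpoch_nat M (Suc n)))
        \<le> 1 / (real n - opnorm M) * opnorm (matrix_inv (mpoch_nat M n))"
      using opnorm_mult_le[OF opnorm_inverse_shift[OF M elim(1)] order_refl] M
      by (simp add: matrix_inv_mult invertible_mpoch_nat)
    then have "u (Suc n) \<le> 1 / (real n - opnorm M) * opnorm (matrix_inv (mpoch_nat M n)) * fact (Suc n)"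
      unfolding u_def by (intro mult_right_mono) auto
    also have "\<dots> = real (Suc n) / (real n - opnorm M) * u n"
      by (simp add: u_def)
    also have "\<dots> \<le> r * u n"
      by (intro mult_right_mono \<open>_ \<le> r\<close>) (simp add: u_def opnorm_nonneg)
    finally show ?case .
  qed
  from ratio_bound_imp_geometric_bound[OF _ _ this] obtain K
    where "K > 0" "\<And>n. u n \<le> K * r ^ n"
    using r by (auto simp: u_def opnorm_nonneg)
  then show ?thesis
    by (intro exI[of _ K]) (simp add: u_def field_simps)
qed

text \<open>For $N \ge k$ the natural size of $(A)_{N-k}$ is $(N-k)!$, and for $N < k$ it is $1/(k-N)!$. In the
  first case $(N-k)! \le N!/k!$ because $\binom{N}{k} \ge 1$, in the second one
  $1/(k-N)! = \binom{k}{N} N!/k! \le 2^k N!/k!$. The factor $2^k$ does no harm because it ends up in an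
  exponential series in $y$.\<close>

lemma mpoch_growth:
  fixes A :: "'d::finite cmat"
  assumes r: "r > 1" and A: "neg_regular A"
  shows "\<exists>K>0. \<forall>N k. opnorm (mpoch A (int N - int k)) \<le> K * r ^ (N + k) * 2 ^ k * fact N / fact k"
proof -
  obtain K1 where K1: "K1 > 0" "\<And>n. opnorm (mpoch_nat A n) \<le> K1 * r ^ n * fact n"
    using mpoch_nat_growth[OF r] by blast
  obtain K2 where K2: "K2 > 0"
    "\<And>n. opnorm (matrix_inv (mpoch_nat (mat 1 - A) n)) \<le> K2 * r ^ n / fact n"
    using inverse_mpoch_nat_growth[OF r neg_regular_invertible[OF A]] by blast
  define K where "K = K1 + K2"
  have "opnorm (mpoch A (int N - int k)) \<le> K * r ^ (N + k) * 2 ^ k * fact N / fact k" for N k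
  proof (cases "k \<le> N")
    case True
    have "(fact (N - k) :: real) \<le> 2 ^ k * (fact N / fact k)"
    proof -
      have "(1::real) * 1 \<le> 2 ^ k * real (N choose k)"
        using True by (intro mult_mono) (auto simp: Suc_le_eq)
      then show ?thesis
        using True by (simp add: binomial_fact field_simps)
    qed
    moreover have "K1 * r ^ (N - k) \<le> K * r ^ (N + k)"
      using r K1 K2 by (intro mult_mono power_increasing) (auto simp: K_def)
    ultimately have "K1 * r ^ (N - k) * fact (N - k) \<le> K * r ^ (N + k) * (2 ^ k * (fact N / fact k))"
      using r K1 K2 by (intro mult_mono) (auto simp: K_def)
    moreover have eq: "int N - int k = int (N - k)"
      using True by simp
    have "opnorm (mpoch A (int N - int k)) = opnorm (mpoch_nat A (N - k))"
      unfolding eq mpoch_of_nat ..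
    ultimately show ?thesis
      using K1(2)[of "N - k"] by simp
  next
    case False
    have "(1 / fact (k - N) :: real) \<le> 2 ^ k * (fact N / fact k)"
    proof -
      have "real (k choose N) \<le> 2 ^ k"
        using binomial_le_pow2[of k N] by (metis of_nat_le_iff of_nat_numeral of_nat_power)
      then show ?thesis
        using False by (simp add: binomial_fact field_simps)
    qed
    moreover have "K2 * r ^ (k - N) \<le> K * r ^ (N + k)"
      using r K1 K2 by (intro mult_mono power_increasing) (auto simp: K_def)
    ultimately have
      "K2 * r ^ (k - N) * (1 / fact (k - N)) \<le> K * r ^ (N + k) * (2 ^ k * (fact N / fact k))"
      using r K1 K2 by (intro mult_mono) (auto simp: K_def)
    moreover have eq: "int N - int k = - int (k - N)"
      using False by simp
    have "opnorm (mpoch A (int N - int k)) = opnorm (matrix_inv (mpoch_nat (mat 1 - A) (k - N)))"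
      unfolding eq mpoch_of_neg by (simp add: opnorm_cscale norm_power)
    ultimately show ?thesis
      using K2(2)[of "k - N"] by simp
  qed
  moreover have "K > 0" using K1 K2 by (simp add: K_def)
  ultimately show ?thesis by blast
qed

text \<open>The index $j$ of $(A)_j$ and the lengths of the other symbols are independent, so that this
  covers the terms of \<open>H2\<close>, where $j = m - k$, $p = m$, $q = k$, and also those of the triple series
  obtained from the three formulae, where one of the indices is increased by $n$.\<close>

definition H2_coefficient ::
  "'d::finite cmat \<Rightarrow> 'd cmat \<Rightarrow> 'd cmat \<Rightarrow> 'd cmat \<Rightarrow> int \<Rightarrow> nat \<Rightarrow> nat \<Rightarrow> nat \<Rightarrow> 'd cmat"
  where "H2_coefficient A B B' C j p q m =
    mpoch A j ** mpoch_nat B p ** mpoch_nat B' q ** matrix_inv (mpoch_nat C m)"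

lemma H2_coefficient_growth:
  fixes A B B' C :: "'d::finite cmat"
  assumes r: "r > 1" and A: "neg_regular A" and C: "\<And>k. invertible (C + mat (of_nat k))"
  shows "\<exists>K>0. \<forall>N k p q m. opnorm (H2_coefficient A B B' C (int N - int k) p q m)
      \<le> K * r ^ (N + k + p + q + m) * 2 ^ k * (fact N * fact p * fact q / (fact k * fact m))"
proof -
  obtain K1 where K1: "K1 > 0"
    "\<And>N k. opnorm (mpoch A (int N - int k)) \<le> K1 * r ^ (N + k) * 2 ^ k * fact N / fact k"
    using mpoch_growth[OF r A] by blast
  obtain K2 where K2: "K2 > 0" "\<And>n. opnorm (mpoch_nat B n) \<le> K2 * r ^ n * fact n"
    using mpoch_nat_growth[OF r] by blast
  obtain K3 where K3: "K3 > 0" "\<And>n. opnorm (mpoch_nat B' n) \<le> K3 * r ^ n * fact n"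
    using mpoch_nat_growth[OF r] by blast
  obtain K4 where K4: "K4 > 0" "\<And>n. opnorm (matrix_inv (mpoch_nat C n)) \<le> K4 * r ^ n / fact n"
    using inverse_mpoch_nat_growth[OF r C] by blast
  have "opnorm (H2_coefficient A B B' C (int N - int k) p q m)
      \<le> (K1 * r ^ (N + k) * 2 ^ k * fact N / fact k) * (K2 * r ^ p * fact p) * (K3 * r ^ q * fact q)
          * (K4 * r ^ m / fact m)" for N k p q m
    unfolding H2_coefficient_def by (intro opnorm_mult_le K1 K2 K3 K4)
  also have "\<And>N k p q m. (K1 * r ^ (N + k) * 2 ^ k * fact N / fact k) * (K2 * r ^ p * fact p)
          * (K3 * r ^ q * fact q) * (K4 * r ^ m / fact m)
      = K1 * K2 * K3 * K4 * r ^ (N + k + p + q + m) * 2 ^ k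
          * (fact N * fact p * fact q / (fact k * fact m))"
    by (simp add: power_add)
  finally show ?thesis
    using K1(1) K2(1) K3(1) K4(1) by (intro exI[of _ "K1 * K2 * K3 * K4"]) simp
qed

section \<open>The power $(1-t)^{-M}$\<close>

text \<open>The exponent is $3$ because three of the four Pochhammer symbols in a term of \<open>H2\<close> have
  the length of the exponent of $x$, and each costs a factor $r$.\<close>

lemma exists_factor_above_one:
  assumes "0 \<le> c" "c < (1::real)"
  shows "\<exists>r>1. r ^ 3 * c < 1"
proof -
  have "((\<lambda>r. r ^ 3 * c) \<longlongrightarrow> 1 ^ 3 * c) (at_right 1)"
    by (intro tendsto_intros)
  then have "eventually (\<lambda>r. r ^ 3 * c < 1) (at_right 1)"
    using assms by (intro order_tendstoD(2)) auto
  then have "eventually (\<lambda>r. r > 1 \<and> r ^ 3 * c < 1) (at_right 1)"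
    by (intro eventually_conj eventually_at_right_less)
  then show ?thesis
    using eventually_happens by fastforce
qed

lemma one_minus_powr_neg_sums:
  fixes M :: "'d::finite cmat"
  assumes t: "norm t < 1"
  shows "(\<lambda>n. (t ^ n / fact n) *\<^sub>C mpoch_nat M n) sums one_minus_powr_neg t M"
proof -
  obtain r where r: "r > 1" "r ^ 3 * norm t < 1"
    using exists_factor_above_one[of "norm t"] t by auto
  have "r ^ 1 * norm t \<le> r ^ 3 * norm t"
    using r by (intro mult_right_mono power_increasing) auto
  with r have rt: "r * norm t < 1" by simp
  obtain K where K: "K > 0" "\<And>n. opnorm (mpoch_nat M n) \<le> K * r ^ n * fact n"
    using mpoch_nat_growth[OF r(1)] by blast
  have "summable (\<lambda>n. K * (r * norm t) ^ n)"
    using r rt by (intro summable_mult summable_geometric) auto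
  then have "(\<lambda>n. K * (r * norm t) ^ n) summable_on UNIV"
    using r K by (subst summable_on_UNIV_nonneg_real_iff) auto
  then have "(\<lambda>n. norm ((t ^ n / fact n) *\<^sub>C mpoch_nat M n)) summable_on UNIV"
  proof (rule abs_summable_on_opnorm_comparison)
    fix n
    have "opnorm ((t ^ n / fact n) *\<^sub>C mpoch_nat M n) = norm t ^ n / fact n * opnorm (mpoch_nat M n)"
      by (simp add: opnorm_cscale norm_divide norm_power)
    also have "\<dots> \<le> norm t ^ n / fact n * (K * r ^ n * fact n)"
      by (intro mult_left_mono K) simp
    finally have "opnorm ((t ^ n / fact n) *\<^sub>C mpoch_nat M n) \<le> norm t ^ n / fact n * (K * r ^ n * fact n)" .
    then show "opnorm ((t ^ n / fact n) *\<^sub>C mpoch_nat M n) \<le> K * (r * norm t) ^ n"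
      by (simp add: power_mult_distrib ac_simps)
  qed
  then have "summable (\<lambda>n. (t ^ n / fact n) *\<^sub>C mpoch_nat M n)"
    by (rule summable_on_imp_summable[OF abs_summable_summable])
  then show ?thesis
    unfolding one_minus_powr_neg_def by (rule summable_sums)
qed

text \<open>Pascal's rule $\binom{a+n+1}{n+1} - \binom{a+n}{n} = \binom{a+n}{n+1}$ for matrix arguments: it is
  the comparison of coefficients of $t^{n+1}$ in $(1-t) (1-t)^{-(M+I)} = (1-t)^{-M}$.\<close>

lemma mpoch_nat_pascal:
  "mpoch_nat (M + mat 1) (Suc n) - of_nat (Suc n) *\<^sub>C mpoch_nat (M + mat 1) n = mpoch_nat M (Suc n)"
proof -
  let ?P = "mpoch_nat (M + mat 1) n"
  have "mpoch_nat (M + mat 1) (Suc n) = ?P ** (M + mat (of_nat (Suc n)))"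
    by (simp add: mat_add add.assoc)
  also have "\<dots> = ?P ** M + of_nat (Suc n) *\<^sub>C ?P"
    by (simp add: matrix_add_ldistrib cscale_eq_mat_mult mat_commute del: of_nat_Suc)
  also have "?P ** M = M ** ?P"
    by (rule mpoch_nat_commute[symmetric]) (simp add: matrix_add_ldistrib matrix_add_rdistrib)
  finally show ?thesis
    by (simp add: mpoch_nat_Suc_shift del: mpoch_nat.simps of_nat_Suc)
qed

lemma one_minus_powr_neg_plus_one:
  fixes M :: "'d::finite cmat"
  assumes t: "norm t < 1"
  shows "(1 - t) *\<^sub>C one_minus_powr_neg t (M + mat 1) = one_minus_powr_neg t M"
proof -
  let ?e = "\<lambda>M n. (t ^ n / fact n) *\<^sub>C mpoch_nat M n :: 'd cmat"
  let ?E = "one_minus_powr_neg t (M + mat 1)"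
  have S: "?e (M + mat 1) sums ?E"
    by (rule one_minus_powr_neg_sums[OF t])
  have "(\<lambda>n. ?e (M + mat 1) (Suc n)) sums (?E - mat 1)"
    using S by (subst sums_Suc_iff) (simp add: cscale_one)
  moreover have "(\<lambda>n. t *\<^sub>C ?e (M + mat 1) n) sums (t *\<^sub>C ?E)"
    by (rule bounded_linear.sums[OF bounded_linear_cscale S])
  ultimately have "(\<lambda>n. ?e (M + mat 1) (Suc n) - t *\<^sub>C ?e (M + mat 1) n) sums (?E - mat 1 - t *\<^sub>C ?E)"
    by (rule sums_diff)
  also have "(\<lambda>n. ?e (M + mat 1) (Suc n) - t *\<^sub>C ?e (M + mat 1) n) = (\<lambda>n. ?e M (Suc n))"
  proof
    fix n
    have "t * (t ^ n / fact n) = (t ^ Suc n / fact (Suc n)) * of_nat (Suc n)"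
      by (simp del: of_nat_Suc)
    then have "?e (M + mat 1) (Suc n) - t *\<^sub>C ?e (M + mat 1) n = (t ^ Suc n / fact (Suc n)) *\<^sub>C
        (mpoch_nat (M + mat 1) (Suc n) - of_nat (Suc n) *\<^sub>C mpoch_nat (M + mat 1) n)"
      by (simp only: cscale_diff_right cscale_cscale)
    then show "?e (M + mat 1) (Suc n) - t *\<^sub>C ?e (M + mat 1) n = ?e M (Suc n)"
      by (simp only: mpoch_nat_pascal)
  qed
  finally have "?e M sums (?E - t *\<^sub>C ?E)"
    by (subst (asm) sums_Suc_iff) (simp add: cscale_one)
  then have "?E - t *\<^sub>C ?E = one_minus_powr_neg t M"
    using one_minus_powr_neg_sums[OF t] sums_unique2 by blast
  then show ?thesis
    by (simp add: cscale_diff_left cscale_one)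
qed

text \<open>The case $j = 1$ is a comparison of coefficients; induction in both directions extends it to
  all integers.\<close>

lemma one_minus_powr_neg_shift:
  fixes M :: "'d::finite cmat"
  assumes t: "norm t < 1"
  shows "one_minus_powr_neg t (M + mat (of_int j)) = (1 - t) powi (- j) *\<^sub>C one_minus_powr_neg t M"
proof (induction j rule: int_induct[where k = 0])
  case base
  show ?case by (simp add: mat_zero cscale_one)
next
  case (step1 i)
  have nz: "1 - t \<noteq> 0" using t by auto
  have "one_minus_powr_neg t (M + mat (of_int i))
      = (1 - t) *\<^sub>C one_minus_powr_neg t (M + mat (of_int (i + 1)))"
    using one_minus_powr_neg_plus_one[OF t, of "M + mat (of_int i)"] by (simp add: mat_add add.assoc)
  then have "one_minus_powr_neg t (M + mat (of_int (i + 1)))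
      = inverse (1 - t) *\<^sub>C (1 - t) powi (- i) *\<^sub>C one_minus_powr_neg t M"
    unfolding step1(2)[symmetric] using nz
    by (simp only: cscale_cscale) (simp add: cscale_one)
  moreover have "inverse (1 - t) * (1 - t) powi (- i) = (1 - t) powi (- (i + 1))"
    unfolding power_int_minus using nz by (simp add: power_int_add)
  ultimately show ?case
    by (simp only: cscale_cscale)
next
  case (step2 i)
  have nz: "1 - t \<noteq> 0" using t by auto
  have "one_minus_powr_neg t (M + mat (of_int (i - 1)))
      = (1 - t) *\<^sub>C one_minus_powr_neg t (M + mat (of_int (i - 1)) + mat 1)"
    by (rule one_minus_powr_neg_plus_one[OF t, symmetric])
  also have "M + mat (of_int (i - 1)) + mat 1 = M + mat (of_int i)"
    using mat_add[of "of_int (i - 1)" 1, where 'd = 'd] by (simp add: add.assoc)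
  also note step2(2)
  also have "(1 - t) *\<^sub>C (1 - t) powi (- i) *\<^sub>C one_minus_powr_neg t M
      = (1 - t) powi (- (i - 1)) *\<^sub>C one_minus_powr_neg t M"
    using nz power_int_add[of "1 - t" 1 "- i"] by (simp only: cscale_cscale) simp
  finally show ?case .
qed

lemma one_minus_powr_neg_commute:
  fixes X M :: "'d::finite cmat"
  assumes t: "norm t < 1" and X: "X ** M = M ** X"
  shows "X ** one_minus_powr_neg t M = one_minus_powr_neg t M ** X"
proof -
  have "(\<lambda>n. X ** ((t ^ n / fact n) *\<^sub>C mpoch_nat M n)) sums (X ** one_minus_powr_neg t M)"
    by (rule bounded_linear.sums[OF bounded_linear_matrix_mult_left one_minus_powr_neg_sums[OF t]])
  also have "(\<lambda>n. X ** ((t ^ n / fact n) *\<^sub>C mpoch_nat M n))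
      = (\<lambda>n. ((t ^ n / fact n) *\<^sub>C mpoch_nat M n) ** X)"
    using mpoch_nat_commute[OF X] by (simp add: cscale_mult_left cscale_mult_right)
  finally show ?thesis
    using bounded_linear.sums[OF bounded_linear_matrix_mult_right one_minus_powr_neg_sums[OF t], of M X]
    by (rule sums_unique2)
qed

section \<open>Summability of the double and triple series\<close>

lemma summable_geometric_exponential:
  fixes a w :: real
  assumes "0 \<le> a" "a < 1" "0 \<le> w"
  shows "(\<lambda>(m, k). a ^ m * (w ^ k / fact k)) summable_on UNIV"
proof -
  have exp: "((\<lambda>k. w ^ k / fact k) has_sum exp w) UNIV"
    using exp_converges[of w] assms
    by (intro norm_summable_imp_has_sum) (auto simp: sums_iff divide_inverse mult.commute)
  have "(\<lambda>m. a ^ m) summable_on UNIV"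
    using assms by (subst summable_on_UNIV_nonneg_real_iff) (auto intro: summable_geometric)
  then have "(\<lambda>m. a ^ m * exp w) summable_on UNIV"
    by (rule summable_on_cmult_left)
  then have "(\<lambda>(m, k). a ^ m * (w ^ k / fact k)) summable_on UNIV \<times> UNIV"
    using assms exp
    by (intro summable_on_SigmaI[where g = "\<lambda>m. a ^ m * exp w"])
       (auto intro: has_sum_cmult_right simp del: times_divide_eq_right)
  then show ?thesis by simp
qed

text \<open>The binomial series with exponent $-(m+1)$.\<close>

lemma negative_binomial_has_sum:
  fixes a :: real
  assumes "0 \<le> a" "a < 1"
  shows "((\<lambda>n. real ((n + m) choose n) * a ^ n) has_sum (1 / (1 - a)) ^ Suc m) UNIV"
proof -
  have "(\<lambda>n. (- real (Suc m) gchoose n) * (- a) ^ n) sums (1 + (- a)) powr (- real (Suc m))"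
    using assms by (intro gen_binomial_real) auto
  moreover have "(- real (Suc m) gchoose n) * (- a) ^ n = real ((n + m) choose n) * a ^ n" for n
  proof -
    have "(- real (Suc m) gchoose n) = (- 1) ^ n * (real (n + m) gchoose n)"
      using gbinomial_minus[of "real (Suc m)" n] by (simp add: algebra_simps)
    moreover have "(- a) ^ n = (- 1) ^ n * a ^ n"
      by (rule power_minus)
    moreover have "(- 1) ^ n * (- 1) ^ n = (1 :: real)"
      by (simp flip: power_mult_distrib)
    ultimately show ?thesis
      by (simp add: binomial_gbinomial)
  qed
  moreover have "(1 + (- a)) powr (- real (Suc m)) = (1 / (1 - a)) ^ Suc m"
    using assms by (simp add: powr_minus powr_realpow field_simps del: of_nat_Suc)
  ultimately have "(\<lambda>n. real ((n + m) choose n) * a ^ n) sums (1 / (1 - a)) ^ Suc m"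
    by simp
  then show ?thesis
    using assms by (intro norm_summable_imp_has_sum) (auto simp: sums_iff)
qed

text \<open>Summing over $n$ first replaces $b$ by $b/(1-a)$, which is less than $1$ exactly if
  $a + b < 1$.\<close>

lemma summable_binomial_left:
  fixes a b w :: real
  assumes "0 \<le> a" "0 \<le> b" "a + b < 1" "0 \<le> w"
  shows "(\<lambda>((m, k), n). real ((n + m) choose n) * a ^ n * b ^ m * (w ^ k / fact k)) summable_on UNIV"
proof -
  define G where "G = (\<lambda>(m, k). (1 / (1 - a)) * ((b / (1 - a)) ^ m * (w ^ k / fact k)))"
  have "G summable_on UNIV"
    using summable_on_cmult_right[OF summable_geometric_exponential[of "b / (1 - a)" w], of "1 / (1 - a)"]
      assms by (simp add: G_def case_prod_unfold)
  moreover have "((\<lambda>n. real ((n + m) choose n) * a ^ n * b ^ m * (w ^ k / fact k)) has_sum G (m, k)) UNIV"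
    for m k
    using has_sum_cmult_left[OF negative_binomial_has_sum[of a m], of "b ^ m * (w ^ k / fact k)"] assms
    by (simp add: G_def power_divide ac_simps)
  ultimately have "(\<lambda>((m, k), n). real ((n + m) choose n) * a ^ n * b ^ m * (w ^ k / fact k))
      summable_on UNIV \<times> UNIV"
    using assms by (intro summable_on_SigmaI[where g = G]) auto
  then show ?thesis by simp
qed

text \<open>Summing over $n$ first replaces $w$ by $w/(1-a)$, which an exponential series tolerates for
  every $w$; this is why $a$ and $b$ can be bounded separately here.\<close>

lemma summable_binomial_right:
  fixes a b w :: real
  assumes "0 \<le> a" "a < 1" "0 \<le> b" "b < 1" "0 \<le> w"
  shows "(\<lambda>((m, k), n). real ((n + k) choose n) * a ^ n * b ^ m * (w ^ k / fact k)) summable_on UNIV"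
proof -
  define G where "G = (\<lambda>(m, k). (1 / (1 - a)) * (b ^ m * ((w / (1 - a)) ^ k / fact k)))"
  have "G summable_on UNIV"
    using summable_on_cmult_right[OF summable_geometric_exponential[of b "w / (1 - a)"], of "1 / (1 - a)"]
      assms by (simp add: G_def case_prod_unfold)
  moreover have "((\<lambda>n. real ((n + k) choose n) * a ^ n * b ^ m * (w ^ k / fact k)) has_sum G (m, k)) UNIV"
    for m k
    using has_sum_cmult_left[OF negative_binomial_has_sum[of a k], of "b ^ m * (w ^ k / fact k)"] assms
    by (simp add: G_def power_divide ac_simps)
  ultimately have "(\<lambda>((m, k), n). real ((n + k) choose n) * a ^ n * b ^ m * (w ^ k / fact k))
      summable_on UNIV \<times> UNIV"
    using assms by (intro summable_on_SigmaI[where g = G]) auto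
  then show ?thesis by simp
qed

lemma sums_exchange:
  fixes T :: "'p \<Rightarrow> nat \<Rightarrow> 'a::banach"
  assumes T: "(\<lambda>(p, n). norm (T p n)) summable_on UNIV"
    and rows: "\<And>n. ((\<lambda>p. T p n) has_sum S n) UNIV"
    and cols: "\<And>p. T p sums G p"
    and G: "(G has_sum R) UNIV"
  shows "S sums R"
proof -
  define F where "F = (\<lambda>(p, n). T p n)"
  have F: "F summable_on UNIV \<times> UNIV"
    using T by - (rule abs_summable_summable, simp add: F_def case_prod_unfold)
  then obtain L where L: "(F has_sum L) (UNIV \<times> UNIV)"
    by (auto simp: summable_on_def)
  have col: "((\<lambda>n. F (p, n)) has_sum G p) UNIV" for p
  proof -
    have "T p summable_on UNIV"
      using summable_on_SigmaD1[of "\<lambda>p n. norm (T p n)" UNIV "\<lambda>_. UNIV" p] T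
      by - (rule abs_summable_summable, simp)
    then have sum: "(T p has_sum infsum (T p) UNIV) UNIV"
      by (rule has_sum_infsum)
    then have "infsum (T p) UNIV = G p"
      using has_sum_imp_sums cols sums_unique2 by blast
    with sum show ?thesis by (simp add: F_def)
  qed
  have "(G has_sum L) UNIV"
    by (rule has_sum_SigmaD[OF L col])
  then have "L = R"
    using G has_sum_unique by blast
  have "((\<lambda>(n, p). F (p, n)) has_sum L) (UNIV \<times> UNIV)"
    using has_sum_swap[THEN iffD1, OF L] by simp
  then have "(S has_sum L) UNIV"
    by (rule has_sum_SigmaD) (use rows in \<open>simp add: F_def\<close>)
  then show ?thesis
    using \<open>L = R\<close> has_sum_imp_sums by blast
qed

text \<open>The majorant depends on the bounds for $|x|$ and $|y|$ only. This uniformity is what makes the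
  series holomorphic in its arguments.\<close>

lemma H2_series_summable:
  fixes A B B' C :: "'d::finite cmat"
  assumes A: "neg_regular A" and C: "\<And>k. invertible (C + mat (of_nat k))" and X: "X < 1"
  shows "\<exists>g. g summable_on UNIV \<and> (\<forall>x y m k. norm x \<le> X \<longrightarrow> norm y \<le> Y \<longrightarrow>
    opnorm ((x ^ m * y ^ k / (fact m * fact k)) *\<^sub>C H2_coefficient A B B' C (int m - int k) m k m)
      \<le> g (m, k))"
proof (cases "X \<ge> 0 \<and> Y \<ge> 0")
  case False
  then have "\<not> (norm (x::complex) \<le> X \<and> norm (y::complex) \<le> Y)" for x y
    using norm_ge_zero order_trans by blast
  then show ?thesis
    by (intro exI[of _ "\<lambda>_. 0"]) auto
next
  case True
  obtain r where r: "r > 1" "r ^ 3 * X < 1"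
    using exists_factor_above_one[of X] X True by auto
  obtain K where K: "K > 0" "\<And>N k p q m. opnorm (H2_coefficient A B B' C (int N - int k) p q m)
      \<le> K * r ^ (N + k + p + q + m) * 2 ^ k * (fact N * fact p * fact q / (fact k * fact m))"
    using H2_coefficient_growth[OF r(1) A C] by metis
  define g where "g = (\<lambda>(m, k). K * ((r ^ 3 * X) ^ m * ((2 * r\<^sup>2 * Y) ^ k / fact k)))"
  have "g summable_on UNIV"
    using summable_on_cmult_right[OF summable_geometric_exponential[of "r ^ 3 * X" "2 * r\<^sup>2 * Y"], of K]
      r True by (simp add: g_def case_prod_unfold)
  moreover have "opnorm ((x ^ m * y ^ k / (fact m * fact k)) *\<^sub>C H2_coefficient A B B' C (int m - int k) m k m)
      \<le> g (m, k)" if "norm x \<le> X" "norm y \<le> Y" for x y :: complex and m k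
  proof -
    have "opnorm ((x ^ m * y ^ k / (fact m * fact k)) *\<^sub>C H2_coefficient A B B' C (int m - int k) m k m)
      = norm x ^ m * norm y ^ k / (fact m * fact k) * opnorm (H2_coefficient A B B' C (int m - int k) m k m)"
      by (simp add: opnorm_cscale norm_mult norm_divide norm_power)
    also have "\<dots> \<le> X ^ m * Y ^ k / (fact m * fact k) *
        (K * r ^ (m + k + m + k + m) * 2 ^ k * (fact m * fact m * fact k / (fact k * fact m)))"
      using that True
      by (intro mult_mono K divide_right_mono power_mono opnorm_nonneg) auto
    also have "m + k + m + k + m = 3 * m + 2 * k"
      by simp
    also have "r ^ (3 * m + 2 * k) = (r ^ 3) ^ m * (r\<^sup>2) ^ k"
      by (simp add: power_mult power_add)
    finally show ?thesis
      by (simp add: g_def power_mult_distrib ac_simps)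
  qed
  ultimately show ?thesis by blast
qed

lemma H2_has_sum:
  fixes A B B' C :: "'d::finite cmat"
  assumes A: "neg_regular A" and C: "\<And>k. invertible (C + mat (of_nat k))" and x: "norm x < 1"
  shows "((\<lambda>(m, k). (x ^ m * y ^ k / (fact m * fact k)) *\<^sub>C H2_coefficient A B B' C (int m - int k) m k m)
    has_sum H2 A B B' C x y) UNIV"
proof -
  obtain g where g: "g summable_on UNIV" "\<And>m k.
    opnorm ((x ^ m * y ^ k / (fact m * fact k)) *\<^sub>C H2_coefficient A B B' C (int m - int k) m k m) \<le> g (m, k)"
    using H2_series_summable[OF A C x, of "norm y" B B'] by blast
  have "(\<lambda>(m, k). (x ^ m * y ^ k / (fact m * fact k)) *\<^sub>C H2_coefficient A B B' C (int m - int k) m k m)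
    summable_on UNIV"
    by (rule abs_summable_summable[OF abs_summable_on_opnorm_comparison[OF g(1)]])
       (use g(2) in auto)
  then show ?thesis
    unfolding H2_def H2_coefficient_def by (rule has_sum_infsum)
qed

section \<open>Continuation of a power series to a boundary point of its disc\<close>

text \<open>Abel's limit theorem. With the tails $T_n = \sum_{k \ge n} b_k \to 0$, summation by parts gives
  $\sum_n b_n r^n = S - (1-r) \sum_n T_{n+1} r^n$, and the last term tends to $0$ because only finitely
  many tails are not small.\<close>

lemma abel_limit:
  fixes b :: "nat \<Rightarrow> complex"
  assumes b: "b sums S"
  shows "((\<lambda>r. \<Sum>n. b n * of_real r ^ n) \<longlongrightarrow> S) (at_left (1::real))"
proof -
  define T where "T n = S - (\<Sum>k<n. b k)" for n
  define V where "V r = (\<Sum>n. T (Suc n) * of_real r ^ n)" for r :: real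
  have T0: "T \<longlonglongrightarrow> 0"
    using tendsto_diff[OF tendsto_const b[unfolded sums_def], of S] by (simp add: T_def[abs_def])
  then have "Bseq T"
    by (intro convergent_imp_Bseq) (auto simp: convergent_def)
  then obtain M where M: "\<And>n. norm (T n) \<le> M"
    by (auto simp: Bseq_def)
  have sumT: "summable (\<lambda>n. norm (T (Suc n) * of_real r ^ n))" if "0 < r" "r < 1" for r :: real
  proof (rule summable_comparison_test')
    show "summable (\<lambda>n. M * r ^ n)"
      using that by (intro summable_mult summable_geometric) auto
    show "norm (norm (T (Suc n) * of_real r ^ n)) \<le> M * r ^ n" for n
      using that M by (auto simp: norm_mult norm_power intro!: mult_right_mono)
  qed
  have eq: "(\<Sum>n. b n * of_real r ^ n) = S - of_real (1 - r) * V r" if r: "0 < r" "r < 1" for r :: real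
  proof -
    have V: "(\<lambda>n. T (Suc n) * of_real r ^ n) sums V r"
      unfolding V_def by (rule summable_sums[OF summable_norm_cancel[OF sumT[OF r]]])
    have "(\<lambda>n. of_real r * (T (Suc n) * of_real r ^ n)) sums (of_real r * V r)"
      by (rule sums_mult[OF V])
    then have "(\<lambda>n. T (Suc n) * of_real r ^ Suc n) sums (of_real r * V r)"
      by (simp add: ac_simps)
    then have "(\<lambda>n. T n * of_real r ^ n) sums (of_real r * V r + S)"
      by (subst (asm) sums_Suc_iff) (simp add: T_def)
    from sums_diff[OF this V]
    have "(\<lambda>n. b n * of_real r ^ n) sums (of_real r * V r + S - V r)"
      by (simp add: T_def algebra_simps)
    then show ?thesis
      by (simp add: sums_iff algebra_simps)
  qed
  have V0: "((\<lambda>r. of_real (1 - r) * V r) \<longlongrightarrow> 0) (at_left 1)"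
    unfolding tendsto_iff
  proof (intro allI impI)
    fix e :: real
    assume e: "e > 0"
    have "eventually (\<lambda>n. norm (T n) < e / 2) sequentially"
      using tendstoD[OF T0, of "e / 2"] e by (simp add: dist_norm)
    then obtain N where N: "\<And>n. n \<ge> N \<Longrightarrow> norm (T n) < e / 2"
      by (auto simp: eventually_sequentially)
    define c where "c = (\<Sum>n<N. norm (T (Suc n)))"
    have bound: "norm (of_real (1 - r) * V r) \<le> (1 - r) * c + e / 2" if r: "0 < r" "r < 1" for r :: real
    proof -
      have d: "(\<lambda>n. if n \<in> {..<N} then norm (T (Suc n)) else 0) sums c"
        unfolding c_def by (rule sums_If_finite_set) simp
      have g: "(\<lambda>n. e / 2 * r ^ n) sums (e / 2 * (1 / (1 - r)))"
        using r by (intro sums_mult geometric_sums) auto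
      have "norm (V r) \<le> (\<Sum>n. norm (T (Suc n) * of_real r ^ n))"
        unfolding V_def by (rule summable_norm[OF sumT[OF r]])
      also have "\<dots> \<le> (\<Sum>n. (if n \<in> {..<N} then norm (T (Suc n)) else 0) + e / 2 * r ^ n)"
      proof (rule suminf_le)
        show "norm (T (Suc n) * of_real r ^ n)
          \<le> (if n \<in> {..<N} then norm (T (Suc n)) else 0) + e / 2 * r ^ n" for n
        proof (cases "n < N")
          case True
          have "norm (T (Suc n)) * r ^ n \<le> norm (T (Suc n)) * 1"
            using r by (intro mult_left_mono) (auto intro: power_le_one)
          moreover have "e / 2 * r ^ n \<ge> 0" using e r by simp
          ultimately show ?thesis
            using True r by (simp add: norm_mult norm_power)
        next
          case False
          have "norm (T (Suc n)) * r ^ n \<le> e / 2 * r ^ n"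
            using N[of "Suc n"] False r by (intro mult_right_mono) auto
          then show ?thesis
            using False r by (simp add: norm_mult norm_power)
        qed
      qed (use sumT[OF r] sums_add[OF d g] in \<open>auto simp: sums_iff\<close>)
      also have "\<dots> = c + e / 2 * (1 / (1 - r))"
        using sums_add[OF d g] by (simp add: sums_iff)
      finally have "(1 - r) * norm (V r) \<le> (1 - r) * (c + e / 2 * (1 / (1 - r)))"
        using r by (intro mult_left_mono) auto
      also have "\<dots> = (1 - r) * c + e / 2"
        using r by (simp add: field_simps)
      finally show ?thesis
        using r by (simp only: norm_mult norm_of_real)
    qed
    have "((\<lambda>r. (1 - r) * c + e / 2) \<longlongrightarrow> (1 - 1) * c + e / 2) (at_left 1)"
      by (intro tendsto_intros)
    then have "eventually (\<lambda>r. (1 - r) * c + e / 2 < e) (at_left 1)"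
      by (rule order_tendstoD(2)) (use e in simp)
    moreover have "eventually (\<lambda>r. r \<in> {0<..<1::real}) (at_left 1)"
      by (rule eventually_at_left_real) simp
    ultimately show "eventually (\<lambda>r. dist (of_real (1 - r) * V r) 0 < e) (at_left 1)"
    proof eventually_elim
      case (elim r)
      with bound[of r] show ?case by (simp add: dist_norm)
    qed
  qed
  have "((\<lambda>r. S - of_real (1 - r) * V r) \<longlongrightarrow> S - 0) (at_left 1)"
    by (intro tendsto_diff tendsto_const V0)
  moreover have "eventually (\<lambda>r. r \<in> {0<..<1::real}) (at_left 1)"
    by (rule eventually_at_left_real) simp
  then have "eventually (\<lambda>r. (\<Sum>n. b n * of_real r ^ n) = S - of_real (1 - r) * V r) (at_left 1)"
    by eventually_elim (use eq in auto)
  ultimately show ?thesis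
    by (simp add: tendsto_cong)
qed

text \<open>The left half of the disc is convex and misses the removed disc around $1$. Any other point of
  the region is joined to it by the horizontal segment to the imaginary axis, along which the distance to
  $0$ decreases and the distance to $1$ increases. Radial segments would not do: they can cross the
  removed disc.\<close>

lemma connected_disc_minus_disc:
  assumes "\<rho> > 0" "\<rho> \<le> 1" "0 \<le> c" "c < 1"
  shows "connected (ball 0 \<rho> \<inter> {s :: complex. c < norm (1 - s)})"
    (is "connected ?U")
proof -
  define W where "W = ball 0 \<rho> \<inter> {s :: complex. Re s \<le> 0}"
  define Q where "Q s = W \<union> closed_segment s (Complex (min (Re s) 0) (Im s))" for s
  have W: "convex W" "0 \<in> W"
    using assms by (auto simp: W_def convex_halfspace_Re_le intro!: convex_Int)
  have WU: "W \<subseteq> ?U"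
  proof
    fix s assume s: "s \<in> W"
    then have "c < Re (1 - s)" using assms by (auto simp: W_def)
    also have "\<dots> \<le> norm (1 - s)" by (rule complex_Re_le_cmod)
    finally show "s \<in> ?U" using s by (simp add: W_def)
  qed
  have Q: "connected (Q s)" "Q s \<subseteq> ?U" "s \<in> Q s" "0 \<in> Q s" if s: "s \<in> ?U" for s
  proof -
    have "Complex (min (Re s) 0) (Im s) \<in> W"
    proof -
      have "norm (Complex (min (Re s) 0) (Im s)) \<le> norm s"
        unfolding cmod_def by (intro real_sqrt_le_mono) (auto simp: min_def)
      then show ?thesis using s by (auto simp: W_def)
    qed
    then have "W \<inter> closed_segment s (Complex (min (Re s) 0) (Im s)) \<noteq> {}"
      by auto
    then show "connected (Q s)"
      unfolding Q_def by (intro connected_Un convex_connected W convex_closed_segment)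
    have "closed_segment s (Complex (min (Re s) 0) (Im s)) \<subseteq> ?U"
    proof
      fix z assume "z \<in> closed_segment s (Complex (min (Re s) 0) (Im s))"
      then obtain u where u: "0 \<le> u" "u \<le> 1" "z = (1 - u) *\<^sub>R s + u *\<^sub>R Complex (min (Re s) 0) (Im s)"
        by (auto simp: in_segment)
      have Im: "Im z = Im s"
        by (simp add: u algebra_simps)
      have Re: "Re z \<le> Re s \<and> \<bar>Re z\<bar> \<le> \<bar>Re s\<bar>"
      proof (cases "Re s \<ge> 0")
        case True
        then show ?thesis using u by (auto simp: mult_left_le_one_le)
      next
        case False
        then show ?thesis using u by (simp add: algebra_simps)
      qed
      have "Re s \<le> norm s" by (rule complex_Re_le_cmod)
      also have "norm s < 1" using s assms by auto
      finally have "\<bar>Re (1 - s)\<bar> \<le> \<bar>Re (1 - z)\<bar>" using Re by auto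
      then have "norm (1 - s) \<le> norm (1 - z)"
        unfolding cmod_def by (intro real_sqrt_le_mono add_mono) (simp_all add: Im abs_le_square_iff)
      moreover have "norm z \<le> norm s"
        unfolding cmod_def using Re
        by (intro real_sqrt_le_mono add_mono) (simp_all add: Im abs_le_square_iff)
      ultimately show "z \<in> ?U" using s by auto
    qed
    with WU show "Q s \<subseteq> ?U" by (auto simp: Q_def)
    show "s \<in> Q s" "0 \<in> Q s" using W by (auto simp: Q_def)
  qed
  have "connected (\<Union>(Q ` ?U))"
  proof (rule connected_Union)
    have "0 \<in> \<Inter>(Q ` ?U)" using Q(4) by blast
    then show "\<Inter>(Q ` ?U) \<noteq> {}" by blast
  qed (use Q in auto)
  also have "\<Union>(Q ` ?U) = ?U"
    using Q by blast
  finally show ?thesis .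
qed

text \<open>The point $t$ may lie on the circle of convergence, and $|t| + c \ge 1$ is possible. The sum
  $F$ of the series and $R$ are both holomorphic on the disc $|s| < |t|$ without the closed disc of radius
  $c$ around $1$; they agree near $0$, hence on this connected set. Near $t$ the radius from $0$ to $t$ lies
  in the set, so Abel's theorem for $F$ and continuity of $R$ give the identity at $t$.\<close>

lemma power_series_sums_continuation:
  fixes a :: "nat \<Rightarrow> complex" and R :: "complex \<Rightarrow> complex"
  assumes c: "0 \<le> c" "c < 1"
    and hol: "R holomorphic_on {s. norm s < 1 \<and> c < norm (1 - s)}"
    and small: "\<And>s. norm s + c < 1 \<Longrightarrow> (\<lambda>n. a n * s ^ n) sums R s"
    and t: "norm t < 1" "c < norm (1 - t)" and sum: "summable (\<lambda>n. a n * t ^ n)"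
  shows "(\<lambda>n. a n * t ^ n) sums R t"
proof (cases "t = 0")
  case True
  then show ?thesis using small[of 0] c by simp
next
  case False
  define \<rho> where "\<rho> = norm t"
  have \<rho>: "\<rho> > 0" "\<rho> < 1" using False t by (auto simp: \<rho>_def)
  define F where "F s = (\<Sum>n. a n * s ^ n)" for s
  define U where "U = ball 0 \<rho> \<inter> {s :: complex. c < norm (1 - s)}"
  have open_c: "open {s :: complex. c < norm (1 - s)}"
    by (intro open_Collect_less continuous_intros)
  have F: "(\<lambda>n. a n * s ^ n) sums F s" if "s \<in> ball 0 \<rho>" for s
    unfolding F_def using that powser_inside[OF sum, of s]
    by (intro summable_sums) (simp add: \<rho>_def)
  have F_hol: "F holomorphic_on ball 0 \<rho>"
    by (rule power_series_holomorphic[where a = a]) (use F in auto)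
  have in_U: "ball 0 (min \<rho> (1 - c)) \<subseteq> U"
  proof
    fix s :: complex assume s: "s \<in> ball 0 (min \<rho> (1 - c))"
    have "norm (1 :: complex) - norm s \<le> norm (1 - s)" by (rule norm_triangle_ineq2)
    then show "s \<in> U" using s by (auto simp: U_def)
  qed
  have FR: "F s = R s" if s: "s \<in> U" for s
  proof (rule analytic_continuation_open[of "ball 0 (min \<rho> (1 - c))" U F R])
    show "ball 0 (min \<rho> (1 - c)) \<noteq> ({} :: complex set)" using \<rho> c by auto
    show "open U" unfolding U_def using open_c by auto
    show "connected U" unfolding U_def using \<rho> c by (intro connected_disc_minus_disc) auto
    show "F holomorphic_on U"
      by (rule holomorphic_on_subset[OF F_hol]) (auto simp: U_def)
    show "R holomorphic_on U"
      by (rule holomorphic_on_subset[OF hol]) (use \<rho> in \<open>auto simp: U_def\<close>)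
    show "F z = R z" if "z \<in> ball 0 (min \<rho> (1 - c))" for z
      using F[of z] small[of z] that sums_unique2 by auto
  qed (use in_U s in auto)
  have path: "((\<lambda>r. of_real r * t) \<longlongrightarrow> t) (at_left (1::real))"
  proof -
    have "((\<lambda>r. of_real r * t) \<longlongrightarrow> of_real 1 * t) (at_left (1::real))"
      by (intro tendsto_intros)
    then show ?thesis by simp
  qed
  have "isCont R t"
  proof -
    have "open ({s :: complex. norm s < 1} \<inter> {s. c < norm (1 - s)})"
      by (intro open_Int open_c open_Collect_less continuous_intros)
    then have "open {s :: complex. norm s < 1 \<and> c < norm (1 - s)}"
      by (simp add: Collect_conj_eq)
    then show ?thesis
      using holomorphic_on_imp_continuous_on[OF hol] t by (simp add: continuous_on_eq_continuous_at)
  qed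
  then have R: "((\<lambda>r. R (of_real r * t)) \<longlongrightarrow> R t) (at_left 1)"
    using path by (rule isCont_tendsto_compose)
  have "((\<lambda>r. \<Sum>n. (a n * t ^ n) * of_real r ^ n) \<longlongrightarrow> (\<Sum>n. a n * t ^ n)) (at_left 1)"
    by (rule abel_limit[OF summable_sums[OF sum]])
  moreover have "eventually (\<lambda>r. (\<Sum>n. (a n * t ^ n) * of_real r ^ n) = R (of_real r * t)) (at_left 1)"
  proof -
    have "eventually (\<lambda>r. of_real r * t \<in> {s. c < norm (1 - s)}) (at_left (1::real))"
      using path open_c t by (intro topological_tendstoD) auto
    moreover have "eventually (\<lambda>r. r \<in> {0<..<1::real}) (at_left 1)"
      by (rule eventually_at_left_real) simp
    ultimately show ?thesis
    proof eventually_elim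
      case (elim r)
      then have "of_real r * t \<in> U"
        using \<rho> by (auto simp: U_def norm_mult \<rho>_def)
      from FR[OF this] show ?case
        by (simp add: F_def power_mult_distrib ac_simps)
    qed
  qed
  ultimately have "((\<lambda>r. R (of_real r * t)) \<longlongrightarrow> (\<Sum>n. a n * t ^ n)) (at_left 1)"
    by (rule Lim_transform_eventually)
  then have "(\<Sum>n. a n * t ^ n) = R t"
    using R by (rule tendsto_unique[rotated]) simp
  then show ?thesis
    using sum by (simp add: sums_iff)
qed

lemma matrix_power_series_sums_continuation:
  fixes a :: "nat \<Rightarrow> 'd::finite cmat"
  assumes c: "0 \<le> c" "c < 1"
    and hol: "\<And>i j. (\<lambda>s. R s $ i $ j) holomorphic_on {s. norm s < 1 \<and> c < norm (1 - s)}"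
    and small: "\<And>s. norm s + c < 1 \<Longrightarrow> (\<lambda>n. s ^ n *\<^sub>C a n) sums R s"
    and t: "norm t < 1" "c < norm (1 - t)" and sum: "summable (\<lambda>n. t ^ n *\<^sub>C a n)"
  shows "(\<lambda>n. t ^ n *\<^sub>C a n) sums R t"
proof -
  from sum obtain L where L: "(\<lambda>n. t ^ n *\<^sub>C a n) sums L"
    by (auto simp: summable_def)
  have entries: "(\<lambda>n. a n $ i $ j * s ^ n) sums (X $ i $ j)" if "(\<lambda>n. s ^ n *\<^sub>C a n) sums X" for s X i j
    using bounded_linear.sums[OF bounded_linear_entry that, of i j] by (simp add: cscale_nth ac_simps)
  have "L $ i $ j = R t $ i $ j" for i j
  proof (rule sums_unique2[OF entries[OF L]])
    show "(\<lambda>n. a n $ i $ j * t ^ n) sums (R t $ i $ j)"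
      using entries[OF L, of i j] by (intro power_series_sums_continuation[OF c hol _ t] entries small)
        (auto simp: sums_iff)
  qed
  then have "L = R t" by (simp add: vec_eq_iff)
  with L show ?thesis by simp
qed

section \<open>Holomorphy of the left-hand sides\<close>

lemma one_minus_powr_neg_holomorphic:
  "(\<lambda>s. one_minus_powr_neg s M $ i $ j) holomorphic_on ball 0 1"
proof (rule power_series_holomorphic[where a = "\<lambda>n. mpoch_nat M n $ i $ j / fact n"])
  fix s :: complex assume "s \<in> ball 0 1"
  then have "(\<lambda>n. (s ^ n / fact n) *\<^sub>C mpoch_nat M n) sums one_minus_powr_neg s M"
    by (intro one_minus_powr_neg_sums) simp
  from bounded_linear.sums[OF bounded_linear_entry this, of i j]
  show "(\<lambda>n. mpoch_nat M n $ i $ j / fact n * (s - 0) ^ n) sums (one_minus_powr_neg s M $ i $ j)"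
    by (simp add: cscale_nth ac_simps)
qed

text \<open>On a compact disc the arguments $f$ and $g$ are bounded, with $|f|$ bounded away from $1$, so
  the double series of holomorphic functions converges uniformly by the Weierstrass test.\<close>

lemma H2_holomorphic:
  fixes A B B' C :: "'d::finite cmat"
  assumes A: "neg_regular A" and C: "\<And>k. invertible (C + mat (of_nat k))"
    and U: "open U" and f: "f holomorphic_on U" and g: "g holomorphic_on U"
    and f_less: "\<And>s. s \<in> U \<Longrightarrow> norm (f s) < 1"
  shows "(\<lambda>s. H2 A B B' C (f s) (g s) $ i $ j) holomorphic_on U"
proof (rule analytic_imp_holomorphic, unfold analytic_on_def, rule ballI)
  fix z assume z: "z \<in> U"
  obtain e where e: "e > 0" "cball z e \<subseteq> U"
    using U z by (meson open_contains_cball)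
  have cont: "continuous_on (cball z e) f" "continuous_on (cball z e) g"
    using f g e holomorphic_on_imp_continuous_on holomorphic_on_subset by blast+
  obtain w where w: "w \<in> cball z e" "\<And>s. s \<in> cball z e \<Longrightarrow> norm (f s) \<le> norm (f w)"
    using continuous_attains_sup[OF compact_cball _ continuous_on_norm[OF cont(1)]] e by auto
  obtain v where v: "v \<in> cball z e" "\<And>s. s \<in> cball z e \<Longrightarrow> norm (g s) \<le> norm (g v)"
    using continuous_attains_sup[OF compact_cball _ continuous_on_norm[OF cont(2)]] e by auto
  define h where "h = (\<lambda>(m, k) s. ((f s ^ m * g s ^ k / (fact m * fact k)) *\<^sub>C
    H2_coefficient A B B' C (int m - int k) m k m) $ i $ j)"
  have "norm (f w) < 1" using w e f_less by blast
  then obtain b where b: "b summable_on UNIV"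
    "\<And>x y m k. norm x \<le> norm (f w) \<Longrightarrow> norm y \<le> norm (g v) \<Longrightarrow>
      opnorm ((x ^ m * y ^ k / (fact m * fact k)) *\<^sub>C H2_coefficient A B B' C (int m - int k) m k m) \<le> b (m, k)"
    using H2_series_summable[OF A C, of "norm (f w)" "norm (g v)" B B'] by blast
  have ulim: "uniform_limit (cball z e) (\<lambda>F s. \<Sum>p\<in>F. h p s) (\<lambda>s. H2 A B B' C (f s) (g s) $ i $ j)
      (finite_subsets_at_top UNIV)"
  proof (rule Weierstrass_m_test_general'[OF _ _ b(1)])
    fix p :: "nat \<times> nat" and s assume s: "s \<in> cball z e"
    obtain m k where p: "p = (m, k)" by force
    show "norm (h p s) \<le> b p"
      unfolding h_def p prod.case
      by (rule order_trans[OF norm_entry_le_opnorm b(2)]) (use w v s in auto)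
  next
    fix s assume s: "s \<in> cball z e"
    then have "norm (f s) < 1" using e f_less by blast
    from has_sum_bounded_linear[OF bounded_linear_entry[of i j] H2_has_sum[OF A C this, where B = B and B' = B' and y = "g s"]]
    show "((\<lambda>p. h p s) has_sum (H2 A B B' C (f s) (g s) $ i $ j)) UNIV"
      by (simp add: h_def case_prod_unfold)
  qed
  have h_hol: "h p holomorphic_on U" for p
    unfolding h_def cscale_nth using f g by (cases p) (auto intro!: holomorphic_intros)
  have "(\<lambda>s. \<Sum>p\<in>F. h p s) holomorphic_on U" for F
    by (intro holomorphic_intros h_hol)
  then have "eventually (\<lambda>F. continuous_on (cball z e) (\<lambda>s. \<Sum>p\<in>F. h p s) \<and>
      (\<lambda>s. \<Sum>p\<in>F. h p s) holomorphic_on ball z e) (finite_subsets_at_top UNIV)"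
    by (intro always_eventually allI conjI)
       (metis e(2) holomorphic_on_imp_continuous_on holomorphic_on_subset,
        metis e(2) ball_subset_cball holomorphic_on_subset)
  then have "(\<lambda>s. H2 A B B' C (f s) (g s) $ i $ j) holomorphic_on ball z e"
    using ulim by (rule holomorphic_uniform_limit) auto
  with e show "\<exists>e>0. (\<lambda>s. H2 A B B' C (f s) (g s) $ i $ j) holomorphic_on ball z e"
    by blast
qed

lemma powr_times_H2_holomorphic:
  fixes A B B' C M :: "'d::finite cmat"
  assumes A: "neg_regular A" and C: "\<And>k. invertible (C + mat (of_nat k))"
    and g: "g holomorphic_on {s. norm s < 1 \<and> norm x < norm (1 - s)}"
  shows "(\<lambda>s. (one_minus_powr_neg s M ** H2 A B B' C (x / (1 - s)) (g s)) $ i $ j)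
    holomorphic_on {s. norm s < 1 \<and> norm x < norm (1 - s)}"
proof -
  let ?U = "{s :: complex. norm s < 1 \<and> norm x < norm (1 - s)}"
  have "open ({s :: complex. norm s < 1} \<inter> {s. norm x < norm (1 - s)})"
    by (intro open_Int open_Collect_less continuous_intros)
  then have U: "open ?U"
    by (simp add: Collect_conj_eq)
  have "(\<lambda>s. H2 A B B' C (x / (1 - s)) (g s) $ k $ j) holomorphic_on ?U" for k
    by (rule H2_holomorphic[OF A C U _ g])
       (auto intro!: holomorphic_intros simp: norm_divide divide_less_eq)
  moreover have "(\<lambda>s. one_minus_powr_neg s M $ i $ k) holomorphic_on ?U" for k
    by (rule holomorphic_on_subset[OF one_minus_powr_neg_holomorphic]) auto
  ultimately show ?thesis
    unfolding matrix_matrix_mult_def by (auto intro!: holomorphic_intros)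
qed

section \<open>Majorants for the triple series\<close>

text \<open>The two choices of $N$ and $P$ are those of the formulae in $A$ and in $B$, where the new
  summation index $n$ lengthens $(A)_{m-k}$ or $(B)_m$. Both produce the factorial $(n+m)!$ and therefore the
  same majorant.\<close>

lemma summable_triple_series_left:
  fixes A B B' C :: "'d::finite cmat" and t x y :: complex and N P :: "nat \<Rightarrow> nat \<Rightarrow> nat"
  assumes A: "neg_regular A" and C: "\<And>k. invertible (C + mat (of_nat k))"
    and tx: "norm t + norm x < 1"
    and NP: "\<And>n m. (N n m = n + m \<and> P n m = m) \<or> (N n m = m \<and> P n m = n + m)"
  shows "(\<lambda>((m, k), n). norm ((t ^ n / fact n * (x ^ m * y ^ k / (fact m * fact k))) *\<^sub>C
    H2_coefficient A B B' C (int (N n m) - int k) (P n m) k m)) summable_on UNIV"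
proof -
  obtain r where r: "r > 1" "r ^ 3 * (norm t + norm x) < 1"
    using exists_factor_above_one[of "norm t + norm x"] tx by auto
  obtain K where K: "K > 0" "\<And>N k p q m. opnorm (H2_coefficient A B B' C (int N - int k) p q m)
      \<le> K * r ^ (N + k + p + q + m) * 2 ^ k * (fact N * fact p * fact q / (fact k * fact m))"
    using H2_coefficient_growth[OF r(1) A C] by metis
  define a b w where "a = r * norm t" and "b = r ^ 3 * norm x" and "w = 2 * r\<^sup>2 * norm y"
  define g where "g = (\<lambda>((m, k), n). K * (real ((n + m) choose n) * a ^ n * b ^ m * (w ^ k / fact k)))"
  have "r ^ 1 * norm t \<le> r ^ 3 * norm t"
    using r by (intro mult_right_mono power_increasing) auto
  then have "a + b < 1"
    using r by (simp add: a_def b_def algebra_simps)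
  then have "(\<lambda>((m, k), n). real ((n + m) choose n) * a ^ n * b ^ m * (w ^ k / fact k)) summable_on UNIV"
    using r by (intro summable_binomial_left) (auto simp: a_def b_def w_def)
  from summable_on_cmult_right[OF this, of K] have "g summable_on UNIV"
    by (simp add: g_def case_prod_unfold)
  then have "(\<lambda>p. norm ((\<lambda>((m, k), n). (t ^ n / fact n * (x ^ m * y ^ k / (fact m * fact k))) *\<^sub>C
    H2_coefficient A B B' C (int (N n m) - int k) (P n m) k m) p)) summable_on UNIV"
  proof (rule abs_summable_on_opnorm_comparison)
    fix p :: "(nat \<times> nat) \<times> nat"
    obtain m k n where p: "p = ((m, k), n)" by (metis prod.exhaust)
    have "opnorm ((t ^ n / fact n * (x ^ m * y ^ k / (fact m * fact k))) *\<^sub>C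
        H2_coefficient A B B' C (int (N n m) - int k) (P n m) k m)
      = norm t ^ n / fact n * (norm x ^ m * norm y ^ k / (fact m * fact k)) *
        opnorm (H2_coefficient A B B' C (int (N n m) - int k) (P n m) k m)"
      by (simp add: opnorm_cscale norm_mult norm_divide norm_power)
    also have "\<dots> \<le> norm t ^ n / fact n * (norm x ^ m * norm y ^ k / (fact m * fact k)) *
        (K * r ^ (N n m + k + P n m + k + m) * 2 ^ k *
          (fact (N n m) * fact (P n m) * fact k / (fact k * fact m)))"
      by (intro mult_left_mono K) simp
    also have "N n m + k + P n m + k + m = n + 3 * m + 2 * k"
      using NP[of n m] by auto
    also have "r ^ (n + 3 * m + 2 * k) = r ^ n * (r ^ 3) ^ m * (r\<^sup>2) ^ k"
      by (simp add: power_mult power_add)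
    also have "fact (N n m) * fact (P n m) * fact k / (fact k * fact m) = (fact (n + m) :: real)"
      using NP[of n m] by (elim disjE) simp_all
    also have "norm t ^ n / fact n * (norm x ^ m * norm y ^ k / (fact m * fact k)) *
        (K * (r ^ n * (r ^ 3) ^ m * (r\<^sup>2) ^ k) * 2 ^ k * fact (n + m)) = g p"
      by (simp add: g_def p a_def b_def w_def power_mult_distrib binomial_fact ac_simps)
    finally show "opnorm ((\<lambda>((m, k), n). (t ^ n / fact n * (x ^ m * y ^ k / (fact m * fact k))) *\<^sub>C
        H2_coefficient A B B' C (int (N n m) - int k) (P n m) k m) p) \<le> g p"
      by (simp add: p)
  qed
  then show ?thesis
    by (simp add: case_prod_unfold)
qed

text \<open>Here $n$ lengthens $(B')_k$, and $(n+k)!/(n!\,k!)$ is multiplied by a remaining $1/k!$ from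
  $(A)_{m-k}$, so that $x$ and $t$ do not compete.\<close>

lemma summable_triple_series_right:
  fixes A B B' C :: "'d::finite cmat" and t x y :: complex
  assumes A: "neg_regular A" and C: "\<And>k. invertible (C + mat (of_nat k))"
    and t: "norm t < 1" and x: "norm x < 1"
  shows "(\<lambda>((m, k), n). norm ((t ^ n / fact n * (x ^ m * y ^ k / (fact m * fact k))) *\<^sub>C
    H2_coefficient A B B' C (int m - int k) m (n + k) m)) summable_on UNIV"
proof -
  obtain r where r: "r > 1" "r ^ 3 * max (norm t) (norm x) < 1"
    using exists_factor_above_one[of "max (norm t) (norm x)"] t x by (auto simp: le_max_iff_disj)
  obtain K where K: "K > 0" "\<And>N k p q m. opnorm (H2_coefficient A B B' C (int N - int k) p q m)
      \<le> K * r ^ (N + k + p + q + m) * 2 ^ k * (fact N * fact p * fact q / (fact k * fact m))"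
    using H2_coefficient_growth[OF r(1) A C] by metis
  define a b w where "a = r * norm t" and "b = r ^ 3 * norm x" and "w = 2 * r\<^sup>2 * norm y"
  define g where "g = (\<lambda>((m, k), n). K * (real ((n + k) choose n) * a ^ n * b ^ m * (w ^ k / fact k)))"
  have "r ^ 1 * norm t \<le> r ^ 3 * max (norm t) (norm x)"
    using r by (intro mult_mono power_increasing) auto
  moreover have "r ^ 3 * norm x \<le> r ^ 3 * max (norm t) (norm x)"
    using r by (intro mult_left_mono) auto
  ultimately have "a < 1" "b < 1"
    unfolding a_def b_def power_one_right using r(2) by linarith+
  then have "(\<lambda>((m, k), n). real ((n + k) choose n) * a ^ n * b ^ m * (w ^ k / fact k)) summable_on UNIV"
    using r by (intro summable_binomial_right) (auto simp: a_def b_def w_def)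
  from summable_on_cmult_right[OF this, of K] have "g summable_on UNIV"
    by (simp add: g_def case_prod_unfold)
  then have "(\<lambda>p. norm ((\<lambda>((m, k), n). (t ^ n / fact n * (x ^ m * y ^ k / (fact m * fact k))) *\<^sub>C
    H2_coefficient A B B' C (int m - int k) m (n + k) m) p)) summable_on UNIV"
  proof (rule abs_summable_on_opnorm_comparison)
    fix p :: "(nat \<times> nat) \<times> nat"
    obtain m k n where p: "p = ((m, k), n)" by (metis prod.exhaust)
    have "opnorm ((t ^ n / fact n * (x ^ m * y ^ k / (fact m * fact k))) *\<^sub>C
        H2_coefficient A B B' C (int m - int k) m (n + k) m)
      = norm t ^ n / fact n * (norm x ^ m * norm y ^ k / (fact m * fact k)) *
        opnorm (H2_coefficient A B B' C (int m - int k) m (n + k) m)"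
      by (simp add: opnorm_cscale norm_mult norm_divide norm_power)
    also have "\<dots> \<le> norm t ^ n / fact n * (norm x ^ m * norm y ^ k / (fact m * fact k)) *
        (K * r ^ (m + k + m + (n + k) + m) * 2 ^ k *
          (fact m * fact m * fact (n + k) / (fact k * fact m)))"
      by (intro mult_left_mono K) simp
    also have "m + k + m + (n + k) + m = n + 3 * m + 2 * k"
      by simp
    also have "r ^ (n + 3 * m + 2 * k) = r ^ n * (r ^ 3) ^ m * (r\<^sup>2) ^ k"
      by (simp add: power_mult power_add)
    also have "norm t ^ n / fact n * (norm x ^ m * norm y ^ k / (fact m * fact k)) *
        (K * (r ^ n * (r ^ 3) ^ m * (r\<^sup>2) ^ k) * 2 ^ k *
          (fact m * fact m * fact (n + k) / (fact k * fact m))) = g p"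
      by (simp add: g_def p a_def b_def w_def power_mult_distrib binomial_fact ac_simps)
    finally show "opnorm ((\<lambda>((m, k), n). (t ^ n / fact n * (x ^ m * y ^ k / (fact m * fact k))) *\<^sub>C
        H2_coefficient A B B' C (int m - int k) m (n + k) m) p) \<le> g p"
      by (simp add: p)
  qed
  then show ?thesis
    by (simp add: case_prod_unfold)
qed

section \<open>The summation formulae in the region of absolute convergence\<close>

lemma norm_divide_one_minus_less:
  fixes x t :: complex
  assumes "norm t + norm x < 1"
  shows "norm (x / (1 - t)) < 1"
proof -
  have "norm (1 :: complex) - norm t \<le> norm (1 - t)" by (rule norm_triangle_ineq2)
  then have "norm x < norm (1 - t)" using assms by simp
  then show ?thesis
    by (simp add: norm_divide divide_less_eq)
qed

text \<open>The three shift lemmas turn the right-hand sides of the formulae into triple series: the factor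
  $(A)_n$, $(B)_n$ or $(B')_n$ outside \<open>H2\<close> merges with the symbol shifted by $nI$ inside it. For $B$ and
  $B'$ it must first move past the symbols in between, hence the commutation hypotheses.\<close>

lemma H2_coefficient_shift_A:
  assumes "neg_regular A" "neg_regular (A + mat (of_nat n))"
  shows "H2_coefficient A B B' C (int n + j) p q m =
    mpoch_nat A n ** H2_coefficient (A + mat (of_nat n)) B B' C j p q m"
  unfolding H2_coefficient_def by (simp add: matrix_mul_assoc mpoch_nat_add_int[OF assms])

lemma H2_coefficient_shift_B:
  assumes "neg_regular A" "A ** B = B ** A"
  shows "H2_coefficient A B B' C j (n + p) q m =
    mpoch_nat B n ** H2_coefficient A (B + mat (of_nat n)) B' C j p q m"
proof -
  have "mpoch A j ** mpoch_nat B n = mpoch_nat B n ** mpoch A j"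
    by (intro mpoch_nat_commute mpoch_commute[symmetric] assms(1)) (simp add: assms(2))
  then show ?thesis
    unfolding H2_coefficient_def mpoch_nat_add by (simp add: matrix_mul_assoc)
qed

lemma H2_coefficient_shift_B':
  fixes A B B' C :: "'d::finite cmat"
  assumes C: "\<And>k. invertible (C + mat (of_nat k))" and BC: "B' ** C = C ** B'"
  shows "H2_coefficient A B B' C j p (n + q) m =
    H2_coefficient A B (B' + mat (of_nat n)) C j p q m ** mpoch_nat B' n"
proof -
  let ?D = "matrix_inv (mpoch_nat C m)"
  have "mpoch_nat B' (n + q) = mpoch_nat (B' + mat (of_nat n)) q ** mpoch_nat B' n"
    unfolding mpoch_nat_add
    by (rule mpoch_nat_commute, rule mpoch_nat_commute[symmetric])
       (simp add: matrix_add_ldistrib matrix_add_rdistrib mat_commute)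
  moreover have "?D ** B' = B' ** ?D"
    by (intro matrix_inv_commute[symmetric] invertible_mpoch_nat C mpoch_nat_commute BC)
  then have "?D ** mpoch_nat B' n = mpoch_nat B' n ** ?D"
    by (rule mpoch_nat_commute)
  ultimately show ?thesis
    unfolding H2_coefficient_def by (simp add: matrix_mul_assoc[symmetric])
qed

text \<open>For fixed $m, k$ and $j = m - k$, the sum over $n$ of $(A)_{n+j} t^n/n! = (A)_j (A+jI)_n t^n/n!$ is
  $(A)_j (1-t)^{-(A+jI)} = (1-t)^{k-m} (1-t)^{-A} (A)_j$, and the scalar $(1-t)^{k-m}$ turns $x^m y^k$ into
  $(x/(1-t))^m (y(1-t))^k$.\<close>

lemma H2_sum_formula_A:
  fixes A B B' C :: "'d::finite cmat" and t x y :: complex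
  assumes A: "\<And>n. neg_regular (A + mat (of_nat n))" and C: "\<And>k. invertible (C + mat (of_nat k))"
    and tx: "norm t + norm x < 1"
  shows "(\<lambda>n. t ^ n *\<^sub>C ((1 / fact n) *\<^sub>C mpoch_nat A n ** H2 (A + mat (of_nat n)) B B' C x y)) sums
    (one_minus_powr_neg t A ** H2 A B B' C (x / (1 - t)) (y * (1 - t)))"
proof -
  have t: "norm t < 1" and x: "norm x < 1"
    using tx norm_ge_zero[of t] norm_ge_zero[of x] by linarith+
  have nz: "1 - t \<noteq> 0" using t by auto
  have A0: "neg_regular A" using A[of 0] by (simp add: mat_zero)
  define z where "z m k = x ^ m * y ^ k / (fact m * fact k)" for m k
  define T where "T = (\<lambda>(m, k) n. (t ^ n / fact n * z m k) *\<^sub>C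
    H2_coefficient A B B' C (int (n + m) - int k) m k m)"
  show ?thesis
  proof (rule sums_exchange[where T = T])
    show "(\<lambda>(p, n). norm (T p n)) summable_on UNIV"
      using summable_triple_series_left[OF A0 C tx,
        where N = "\<lambda>n m. n + m" and P = "\<lambda>n m. m" and B = B and B' = B' and y = y]
      by (simp add: T_def z_def case_prod_unfold)
  next
    fix n
    let ?h = "\<lambda>X. t ^ n *\<^sub>C ((1 / fact n) *\<^sub>C mpoch_nat A n ** X)"
    have h: "bounded_linear ?h"
      by (rule bounded_linear_compose[OF bounded_linear_cscale bounded_linear_matrix_mult_left])
    have "(\<lambda>p. ?h ((\<lambda>(m, k). z m k *\<^sub>C H2_coefficient (A + mat (of_nat n)) B B' C (int m - int k) m k m) p))
        = (\<lambda>p. T p n)"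
    proof
      fix p :: "nat \<times> nat"
      obtain m k where p: "p = (m, k)" by force
      have "int (n + m) - int k = int n + (int m - int k)" by simp
      then show "?h ((\<lambda>(m, k). z m k *\<^sub>C H2_coefficient (A + mat (of_nat n)) B B' C (int m - int k) m k m) p)
        = T p n"
        unfolding T_def p prod.case
        by (simp only: H2_coefficient_shift_A[OF A0 A] cscale_mult_left cscale_mult_right cscale_cscale) simp
    qed
    then show "((\<lambda>p. T p n) has_sum ?h (H2 (A + mat (of_nat n)) B B' C x y)) UNIV"
      using has_sum_bounded_linear[OF h H2_has_sum[OF A[of n] C x, where B = B and B' = B' and y = y]] unfolding z_def by simp
  next
    fix p :: "nat \<times> nat"
    obtain m k where p: "p = (m, k)" by force
    let ?j = "int m - int k"
    let ?D = "mpoch_nat B m ** mpoch_nat B' k ** matrix_inv (mpoch_nat C m)"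
    let ?h = "\<lambda>X. z m k *\<^sub>C (mpoch A ?j ** X ** ?D)"
    have h: "bounded_linear ?h"
      by (intro bounded_linear_compose[OF bounded_linear_cscale]
          bounded_linear_compose[OF bounded_linear_matrix_mult_right] bounded_linear_matrix_mult_left)
    have "T p n = ?h ((t ^ n / fact n) *\<^sub>C mpoch_nat (A + mat (of_int ?j)) n)" for n
    proof -
      have "int (n + m) - int k = ?j + int n" by simp
      then show ?thesis
        unfolding T_def p prod.case H2_coefficient_def
        by (simp only: mpoch_add_nat[OF A0] cscale_mult_left cscale_mult_right cscale_cscale matrix_mul_assoc)
          (simp add: mult.commute)
    qed
    then have "T p = (\<lambda>n. ?h ((t ^ n / fact n) *\<^sub>C mpoch_nat (A + mat (of_int ?j)) n))"
      by (rule ext)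
    then have "T p sums ?h (one_minus_powr_neg t (A + mat (of_int ?j)))"
      using bounded_linear.sums[OF h one_minus_powr_neg_sums[OF t]] by (simp only:)
    also have "?h (one_minus_powr_neg t (A + mat (of_int ?j)))
      = (z m k * (1 - t) powi (- ?j)) *\<^sub>C (mpoch A ?j ** one_minus_powr_neg t A ** ?D)"
      by (simp only: one_minus_powr_neg_shift[OF t] cscale_mult_left cscale_mult_right cscale_cscale)
    also have "mpoch A ?j ** one_minus_powr_neg t A = one_minus_powr_neg t A ** mpoch A ?j"
      by (intro one_minus_powr_neg_commute[OF t] mpoch_commute[symmetric] A0 refl)
    also have "z m k * (1 - t) powi (- ?j) = (x / (1 - t)) ^ m * (y * (1 - t)) ^ k / (fact m * fact k)"
      using nz power_int_diff[of "1 - t" "int k" "int m"]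
      by (simp add: z_def power_divide power_mult_distrib ac_simps)
    finally show "T p sums (\<lambda>(m, k). one_minus_powr_neg t A **
        (((x / (1 - t)) ^ m * (y * (1 - t)) ^ k / (fact m * fact k)) *\<^sub>C
        H2_coefficient A B B' C (int m - int k) m k m)) p"
      by (simp add: p H2_coefficient_def cscale_mult_right matrix_mul_assoc)
  next
    show "((\<lambda>(m, k). one_minus_powr_neg t A ** (((x / (1 - t)) ^ m * (y * (1 - t)) ^ k / (fact m * fact k)) *\<^sub>C
        H2_coefficient A B B' C (int m - int k) m k m)) has_sum
        (one_minus_powr_neg t A ** H2 A B B' C (x / (1 - t)) (y * (1 - t)))) UNIV"
      using has_sum_bounded_linear[OF bounded_linear_matrix_mult_left[of "one_minus_powr_neg t A"]
          H2_has_sum[OF A0 C norm_divide_one_minus_less[OF tx], where B = B and B' = B' and y = "y * (1 - t)"]]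
      by (simp add: case_prod_unfold)
  qed
qed

text \<open>As for $A$, with $(B)_{n+m} = (B)_m (B+mI)_n$. The scalar $(1-t)^{-m}$ only affects the powers of
  $x$, and $(1-t)^{-B}$ is moved to the front past $(A)_{m-k}$.\<close>

lemma H2_sum_formula_B:
  fixes A B B' C :: "'d::finite cmat" and t x y :: complex
  assumes A: "neg_regular A" and C: "\<And>k. invertible (C + mat (of_nat k))"
    and AB: "A ** B = B ** A" and tx: "norm t + norm x < 1"
  shows "(\<lambda>n. t ^ n *\<^sub>C ((1 / fact n) *\<^sub>C mpoch_nat B n ** H2 A (B + mat (of_nat n)) B' C x y)) sums
    (one_minus_powr_neg t B ** H2 A B B' C (x / (1 - t)) y)"
proof -
  have t: "norm t < 1" and x: "norm x < 1"
    using tx norm_ge_zero[of t] norm_ge_zero[of x] by linarith+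
  have nz: "1 - t \<noteq> 0" using t by auto
  define z where "z m k = x ^ m * y ^ k / (fact m * fact k)" for m k
  define T where "T = (\<lambda>(m, k) n. (t ^ n / fact n * z m k) *\<^sub>C
    H2_coefficient A B B' C (int m - int k) (n + m) k m)"
  show ?thesis
  proof (rule sums_exchange[where T = T])
    show "(\<lambda>(p, n). norm (T p n)) summable_on UNIV"
      using summable_triple_series_left[OF A C tx,
        where N = "\<lambda>n m. m" and P = "\<lambda>n m. n + m" and B = B and B' = B' and y = y]
      by (simp add: T_def z_def case_prod_unfold)
  next
    fix n
    let ?h = "\<lambda>X. t ^ n *\<^sub>C ((1 / fact n) *\<^sub>C mpoch_nat B n ** X)"
    have h: "bounded_linear ?h"
      by (rule bounded_linear_compose[OF bounded_linear_cscale bounded_linear_matrix_mult_left])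
    have "(\<lambda>p. ?h ((\<lambda>(m, k). z m k *\<^sub>C H2_coefficient A (B + mat (of_nat n)) B' C (int m - int k) m k m) p))
        = (\<lambda>p. T p n)"
    proof
      fix p :: "nat \<times> nat"
      obtain m k where p: "p = (m, k)" by force
      show "?h ((\<lambda>(m, k). z m k *\<^sub>C H2_coefficient A (B + mat (of_nat n)) B' C (int m - int k) m k m) p)
        = T p n"
        unfolding T_def p prod.case
        by (simp only: H2_coefficient_shift_B[OF A AB] cscale_mult_left cscale_mult_right cscale_cscale) simp
    qed
    then show "((\<lambda>p. T p n) has_sum ?h (H2 A (B + mat (of_nat n)) B' C x y)) UNIV"
      using has_sum_bounded_linear[OF h H2_has_sum[OF A C x, where B = "B + mat (of_nat n)" and B' = B' and y = y]]
      unfolding z_def by simp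
  next
    fix p :: "nat \<times> nat"
    obtain m k where p: "p = (m, k)" by force
    let ?j = "int m - int k"
    let ?D = "mpoch_nat B' k ** matrix_inv (mpoch_nat C m)"
    let ?L = "mpoch A ?j ** mpoch_nat B m"
    let ?h = "\<lambda>X. z m k *\<^sub>C (?L ** X ** ?D)"
    have h: "bounded_linear ?h"
      by (intro bounded_linear_compose[OF bounded_linear_cscale]
          bounded_linear_compose[OF bounded_linear_matrix_mult_right] bounded_linear_matrix_mult_left)
    have "T p n = ?h ((t ^ n / fact n) *\<^sub>C mpoch_nat (B + mat (of_nat m)) n)" for n
    proof -
      have "mpoch_nat B (n + m) = mpoch_nat B m ** mpoch_nat (B + mat (of_nat m)) n"
        using mpoch_nat_add[of B m n] by (simp add: add.commute)
      then show ?thesis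
        unfolding T_def p prod.case H2_coefficient_def
        by (simp only: cscale_mult_left cscale_mult_right cscale_cscale matrix_mul_assoc)
          (simp add: mult.commute)
    qed
    then have "T p = (\<lambda>n. ?h ((t ^ n / fact n) *\<^sub>C mpoch_nat (B + mat (of_nat m)) n))"
      by (rule ext)
    then have "T p sums ?h (one_minus_powr_neg t (B + mat (of_nat m)))"
      using bounded_linear.sums[OF h one_minus_powr_neg_sums[OF t]] by (simp only:)
    also have "?h (one_minus_powr_neg t (B + mat (of_nat m)))
      = (z m k * (1 - t) powi (- int m)) *\<^sub>C (?L ** one_minus_powr_neg t B ** ?D)"
      using one_minus_powr_neg_shift[OF t, of B "int m"]
      by (simp only: of_int_of_nat_eq cscale_mult_left cscale_mult_right cscale_cscale)
    also have "?L ** one_minus_powr_neg t B = one_minus_powr_neg t B ** ?L"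
    proof (rule one_minus_powr_neg_commute[OF t])
      have "B ** ?L = ?L ** B"
        by (metis AB A mpoch_commute mpoch_nat_commute matrix_mul_assoc)
      then show "?L ** B = B ** ?L" ..
    qed
    also have "z m k * (1 - t) powi (- int m) = (x / (1 - t)) ^ m * y ^ k / (fact m * fact k)"
      using nz by (simp add: z_def power_int_minus power_divide field_simps)
    finally show "T p sums (\<lambda>(m, k). one_minus_powr_neg t B **
        (((x / (1 - t)) ^ m * y ^ k / (fact m * fact k)) *\<^sub>C
        H2_coefficient A B B' C (int m - int k) m k m)) p"
      by (simp add: p H2_coefficient_def cscale_mult_right matrix_mul_assoc)
  next
    show "((\<lambda>(m, k). one_minus_powr_neg t B ** (((x / (1 - t)) ^ m * y ^ k / (fact m * fact k)) *\<^sub>C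
        H2_coefficient A B B' C (int m - int k) m k m)) has_sum
        (one_minus_powr_neg t B ** H2 A B B' C (x / (1 - t)) y)) UNIV"
      using has_sum_bounded_linear[OF bounded_linear_matrix_mult_left[of "one_minus_powr_neg t B"]
          H2_has_sum[OF A C norm_divide_one_minus_less[OF tx], where B = B and B' = B' and y = y]]
      by (simp add: case_prod_unfold)
  qed
qed

text \<open>As for $B$, with $(B')_{n+k} = (B')_k (B'+kI)_n$, but $(1-t)^{-B'}$ is moved to the back past
  $(C)_m^{-1}$.\<close>

lemma H2_sum_formula_B':
  fixes A B B' C :: "'d::finite cmat" and t x y :: complex
  assumes A: "neg_regular A" and C: "\<And>k. invertible (C + mat (of_nat k))"
    and BC: "B' ** C = C ** B'" and t: "norm t < 1" and x: "norm x < 1"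
  shows "(\<lambda>n. t ^ n *\<^sub>C (H2 A B (B' + mat (of_nat n)) C x y ** ((1 / fact n) *\<^sub>C mpoch_nat B' n))) sums
    (H2 A B B' C x (y / (1 - t)) ** one_minus_powr_neg t B')"
proof -
  have nz: "1 - t \<noteq> 0" using t by auto
  define z where "z m k = x ^ m * y ^ k / (fact m * fact k)" for m k
  define T where "T = (\<lambda>(m, k) n. (t ^ n / fact n * z m k) *\<^sub>C
    H2_coefficient A B B' C (int m - int k) m (n + k) m)"
  show ?thesis
  proof (rule sums_exchange[where T = T])
    show "(\<lambda>(p, n). norm (T p n)) summable_on UNIV"
      using summable_triple_series_right[OF A C t x, where B = B and B' = B' and y = y]
      by (simp add: T_def z_def case_prod_unfold)
  next
    fix n
    let ?h = "\<lambda>X. t ^ n *\<^sub>C (X ** ((1 / fact n) *\<^sub>C mpoch_nat B' n))"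
    have h: "bounded_linear ?h"
      by (rule bounded_linear_compose[OF bounded_linear_cscale bounded_linear_matrix_mult_right])
    have "(\<lambda>p. ?h ((\<lambda>(m, k). z m k *\<^sub>C H2_coefficient A B (B' + mat (of_nat n)) C (int m - int k) m k m) p))
        = (\<lambda>p. T p n)"
    proof
      fix p :: "nat \<times> nat"
      obtain m k where p: "p = (m, k)" by force
      show "?h ((\<lambda>(m, k). z m k *\<^sub>C H2_coefficient A B (B' + mat (of_nat n)) C (int m - int k) m k m) p)
        = T p n"
        unfolding T_def p prod.case
        by (simp only: H2_coefficient_shift_B'[OF C BC] cscale_mult_left cscale_mult_right cscale_cscale) simp
    qed
    then show "((\<lambda>p. T p n) has_sum ?h (H2 A B (B' + mat (of_nat n)) C x y)) UNIV"
      using has_sum_bounded_linear[OF h H2_has_sum[OF A C x, where B = B and B' = "B' + mat (of_nat n)" and y = y]]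
      unfolding z_def by simp
  next
    fix p :: "nat \<times> nat"
    obtain m k where p: "p = (m, k)" by force
    let ?j = "int m - int k"
    let ?D = "matrix_inv (mpoch_nat C m)"
    let ?L = "mpoch A ?j ** mpoch_nat B m ** mpoch_nat B' k"
    let ?h = "\<lambda>X. z m k *\<^sub>C (?L ** X ** ?D)"
    have h: "bounded_linear ?h"
      by (intro bounded_linear_compose[OF bounded_linear_cscale]
          bounded_linear_compose[OF bounded_linear_matrix_mult_right] bounded_linear_matrix_mult_left)
    have "T p n = ?h ((t ^ n / fact n) *\<^sub>C mpoch_nat (B' + mat (of_nat k)) n)" for n
    proof -
      have "mpoch_nat B' (n + k) = mpoch_nat B' k ** mpoch_nat (B' + mat (of_nat k)) n"
        using mpoch_nat_add[of B' k n] by (simp add: add.commute)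
      then show ?thesis
        unfolding T_def p prod.case H2_coefficient_def
        by (simp only: cscale_mult_left cscale_mult_right cscale_cscale matrix_mul_assoc)
          (simp add: mult.commute)
    qed
    then have "T p = (\<lambda>n. ?h ((t ^ n / fact n) *\<^sub>C mpoch_nat (B' + mat (of_nat k)) n))"
      by (rule ext)
    then have "T p sums ?h (one_minus_powr_neg t (B' + mat (of_nat k)))"
      using bounded_linear.sums[OF h one_minus_powr_neg_sums[OF t]] by (simp only:)
    also have "?h (one_minus_powr_neg t (B' + mat (of_nat k)))
      = (z m k * (1 - t) powi (- int k)) *\<^sub>C (?L ** (one_minus_powr_neg t B' ** ?D))"
      using one_minus_powr_neg_shift[OF t, of B' "int k"]
      by (simp only: of_int_of_nat_eq cscale_mult_left cscale_mult_right cscale_cscale matrix_mul_assoc)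
    also have "one_minus_powr_neg t B' ** ?D = ?D ** one_minus_powr_neg t B'"
      by (intro one_minus_powr_neg_commute[OF t, symmetric] matrix_inv_commute[symmetric]
          invertible_mpoch_nat C mpoch_nat_commute BC)
    also have "z m k * (1 - t) powi (- int k) = x ^ m * (y / (1 - t)) ^ k / (fact m * fact k)"
      using nz by (simp add: z_def power_int_minus power_divide field_simps)
    finally show "T p sums (\<lambda>(m, k). ((x ^ m * (y / (1 - t)) ^ k / (fact m * fact k)) *\<^sub>C
        H2_coefficient A B B' C (int m - int k) m k m) ** one_minus_powr_neg t B') p"
      by (simp add: p H2_coefficient_def cscale_mult_left matrix_mul_assoc)
  next
    show "((\<lambda>(m, k). ((x ^ m * (y / (1 - t)) ^ k / (fact m * fact k)) *\<^sub>C
        H2_coefficient A B B' C (int m - int k) m k m) ** one_minus_powr_neg t B') has_sum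
        (H2 A B B' C x (y / (1 - t)) ** one_minus_powr_neg t B')) UNIV"
      using has_sum_bounded_linear[OF bounded_linear_matrix_mult_right[of "one_minus_powr_neg t B'"]
          H2_has_sum[OF A C x, where B = B and B' = B' and y = "y / (1 - t)"]]
      by (simp add: case_prod_unfold)
  qed
qed

section \<open>The infinite summation formulae\<close>

theorem theorem5p14:
  fixes A B B' C :: "complex ^ 'd ^ ('d::finite)"
  assumes C_inv: "\<And>k::nat. invertible (C + mat (of_nat k))"
    and A_inv: "\<And>k::nat. k \<ge> 1 \<Longrightarrow> invertible (A - mat (of_nat k))"
  shows
   "((\<forall>k::int. invertible (A + mat (of_int k))) \<longrightarrow>
      (\<forall>x y t :: complex.
         let S = (\<lambda>n. t ^ n *\<^sub>C
                   ((1 / fact n) *\<^sub>C mpoch_nat A n ** H2 (A + mat (of_nat n)) B B' C x y))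
         in norm t < 1 \<and> norm x < 1 \<and> norm (x / (1 - t)) < 1
            \<and> (norm x + norm t < 1 \<or> summable S)
            \<longrightarrow> S sums (one_minus_powr_neg t A ** H2 A B B' C (x / (1 - t)) (y * (1 - t)))))
    \<and>
    (A ** B = B ** A \<longrightarrow>
      (\<forall>x y t :: complex.
         let S = (\<lambda>n. t ^ n *\<^sub>C
                   ((1 / fact n) *\<^sub>C mpoch_nat B n ** H2 A (B + mat (of_nat n)) B' C x y))
         in norm t < 1 \<and> norm x < 1 \<and> norm (x / (1 - t)) < 1
            \<and> (norm x + norm t < 1 \<or> summable S)
            \<longrightarrow> S sums (one_minus_powr_neg t B ** H2 A B B' C (x / (1 - t)) y)))
    \<and>
    (B' ** C = C ** B' \<longrightarrow>
      (\<forall>x y t :: complex.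
         norm t < 1 \<and> norm x < 1 \<longrightarrow>
         (\<lambda>n. t ^ n *\<^sub>C
            (H2 A B (B' + mat (of_nat n)) C x y ** ((1 / fact n) *\<^sub>C mpoch_nat B' n)))
         sums (H2 A B B' C x (y / (1 - t)) ** one_minus_powr_neg t B')))"
proof -
  have A: "neg_regular A"
    using A_inv by (simp add: neg_regular_def)
  have region: "norm x < norm (1 - t)" if "norm t < 1" "norm (x / (1 - t)) < 1" for x t :: complex
    using that by (auto simp: norm_divide divide_less_eq split: if_splits)
  show ?thesis
  proof (intro conjI impI allI)
    fix x y t :: complex
    assume all: "\<forall>k::int. invertible (A + mat (of_int k))"
    have An: "neg_regular (A + mat (of_nat n))" for n
      unfolding neg_regular_def
    proof (intro allI impI)
      fix k :: nat
      have eq: "A + mat (of_nat n) - mat (of_nat k) = A + mat (of_int (int n - int k))"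
        by (simp add: vec_eq_iff mat_def)
      show "invertible (A + mat (of_nat n) - mat (of_nat k))"
        unfolding eq using all by blast
    qed
    define a where "a n = (1 / fact n) *\<^sub>C mpoch_nat A n ** H2 (A + mat (of_nat n)) B B' C x y" for n
    define R where "R s = one_minus_powr_neg s A ** H2 A B B' C (x / (1 - s)) (y * (1 - s))" for s
    have abs: "(\<lambda>n. s ^ n *\<^sub>C a n) sums R s" if "norm s + norm x < 1" for s
      unfolding a_def R_def using H2_sum_formula_A[OF An C_inv that] .
    have hol: "(\<lambda>s. R s $ i $ j) holomorphic_on {s. norm s < 1 \<and> norm x < norm (1 - s)}" for i j
      unfolding R_def by (rule powr_times_H2_holomorphic[OF A C_inv]) (intro holomorphic_intros)
    have "(\<lambda>n. t ^ n *\<^sub>C a n) sums R t"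
      if "norm t < 1" "norm x < 1" "norm (x / (1 - t)) < 1"
        and "norm x + norm t < 1 \<or> summable (\<lambda>n. t ^ n *\<^sub>C a n)"
      using that(4)
    proof
      assume "summable (\<lambda>n. t ^ n *\<^sub>C a n)"
      with that region[OF that(1,3)] show ?thesis
        by (intro matrix_power_series_sums_continuation[OF norm_ge_zero[of x] _ hol abs]) auto
    qed (use abs in \<open>simp add: add.commute\<close>)
    then show "let S = (\<lambda>n. t ^ n *\<^sub>C
                   ((1 / fact n) *\<^sub>C mpoch_nat A n ** H2 (A + mat (of_nat n)) B B' C x y))
         in norm t < 1 \<and> norm x < 1 \<and> norm (x / (1 - t)) < 1
            \<and> (norm x + norm t < 1 \<or> summable S)
            \<longrightarrow> S sums (one_minus_powr_neg t A ** H2 A B B' C (x / (1 - t)) (y * (1 - t)))"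
      unfolding Let_def a_def R_def by blast
  next
    fix x y t :: complex
    assume AB: "A ** B = B ** A"
    define a where "a n = (1 / fact n) *\<^sub>C mpoch_nat B n ** H2 A (B + mat (of_nat n)) B' C x y" for n
    define R where "R s = one_minus_powr_neg s B ** H2 A B B' C (x / (1 - s)) y" for s
    have abs: "(\<lambda>n. s ^ n *\<^sub>C a n) sums R s" if "norm s + norm x < 1" for s
      unfolding a_def R_def using H2_sum_formula_B[OF A C_inv AB that] .
    have hol: "(\<lambda>s. R s $ i $ j) holomorphic_on {s. norm s < 1 \<and> norm x < norm (1 - s)}" for i j
      unfolding R_def by (rule powr_times_H2_holomorphic[OF A C_inv]) (intro holomorphic_intros)
    have "(\<lambda>n. t ^ n *\<^sub>C a n) sums R t"
      if "norm t < 1" "norm x < 1" "norm (x / (1 - t)) < 1"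
        and "norm x + norm t < 1 \<or> summable (\<lambda>n. t ^ n *\<^sub>C a n)"
      using that(4)
    proof
      assume "summable (\<lambda>n. t ^ n *\<^sub>C a n)"
      with that region[OF that(1,3)] show ?thesis
        by (intro matrix_power_series_sums_continuation[OF norm_ge_zero[of x] _ hol abs]) auto
    qed (use abs in \<open>simp add: add.commute\<close>)
    then show "let S = (\<lambda>n. t ^ n *\<^sub>C
                   ((1 / fact n) *\<^sub>C mpoch_nat B n ** H2 A (B + mat (of_nat n)) B' C x y))
         in norm t < 1 \<and> norm x < 1 \<and> norm (x / (1 - t)) < 1
            \<and> (norm x + norm t < 1 \<or> summable S)
            \<longrightarrow> S sums (one_minus_powr_neg t B ** H2 A B B' C (x / (1 - t)) y)"
      unfolding Let_def a_def R_def by blast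
  next
    fix x y t :: complex
    assume "B' ** C = C ** B'" "norm t < 1 \<and> norm x < 1"
    then show "(\<lambda>n. t ^ n *\<^sub>C
            (H2 A B (B' + mat (of_nat n)) C x y ** ((1 / fact n) *\<^sub>C mpoch_nat B' n)))
         sums (H2 A B B' C x (y / (1 - t)) ** one_minus_powr_neg t B')"
      by (intro H2_sum_formula_B' A C_inv) auto
  qed
qed

end
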